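(* Suppose that $d\ge2$, $r>0$, and $\lambda>0$ satisfies $$\lambda>-\frac{\log(1-p_c(d))}{a(d,2r)}.$$ Then $$\mu_c(\lambda,r)\le-\frac{1}{a(d,2r)}\log\left[1-\left(\frac{p_c(d)}{1-e^{-\lambda a(d,2r)}}\right)\right].$$
   Context: Let $\Phi^{(1)}$ and $\Phi^{(2)}$ be independent homogeneous Poisson point processes in $\mathbb{R}^d$, $d\ge2$, with intensities $\lambda>0$ and $\mu>0$ respectively; $|\cdot|$ is the Euclidean norm. A graph percolates if it contains an infinite connected component. The continuum $AB$ percolation model $G(\lambda,\mu,r)$ is the graph with vertex set $\Phi^{(1)}$ and an edge between distinct $X_i,X_j\in\Phi^{(1)}$ whenever there is some $Y\in\Phi^{(2)}$ with $|X_i-Y|\le 2r$ and $|X_j-Y|\le 2r$. Let $\theta(\lambda,\mu,r)=\mathsf{P}(G(\lambda,\mu,r)\text{ percolates})$ and, for fixed $\lambda,r>0$, define $\mu_c(\lambda,r):=\sup\{\mu>0:\theta(\lambda,\mu,r)=0\}$. The quantities $p_c(d)$ and $a(d,\rho)$, $\rho>0$, are defined as follows. For $d=2$: consider the triangular lattice in the plane with edge length $\rho/2$. $p_c(2)$ is the critical probability for Bernoulli site percolation on this lattice (it is known that $p_c(2)=1/2$). Around each vertex place the "flower" bounded by arcs of the 6 circles of radius $\rho/2$ centred at the mid-points of the 6 edges adjacent to the vertex, i.e. the flower is the intersection of the 6 closed discs of radius $\rho/2$ centred at these mid-points; $a(2,\rho)$ is the area of a flower. For $d\ge3$: $p_c(d)$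 is the critical probability for Bernoulli site percolation on the graph with vertex set $\mathbb{Z}^d$ and edges between $z,z_1$ with $|z-z_1|_\infty=1$ ($l_\infty$-norm); and $a(d,\rho)=\left(\frac{\rho}{2\sqrt d}\right)^d$. It is known that $p_c(d)<1$. *)

theory Defs
  imports "HOL-Probability.Probability"
begin

section \<open>Percolation\<close>

text \<open>A graph is given by a vertex set \<open>V\<close> and a symmetric adjacency predicate \<open>E\<close>, which is only
  looked at on \<open>V\<close>.\<close>

definition components :: "'v set \<Rightarrow> ('v \<Rightarrow> 'v \<Rightarrow> bool) \<Rightarrow> 'v set set" where
  "components V E = V // {(u, v). u \<in> V \<and> v \<in> V \<and> E u v}\<^sup>*"

definition percolates :: "'v set \<Rightarrow> ('v \<Rightarrow> 'v \<Rightarrow> bool) \<Rightarrow> bool" where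
  "percolates V E \<longleftrightarrow> (\<exists>C\<in>components V E. infinite C)"

definition site_perc_prob :: "'v set \<Rightarrow> ('v \<Rightarrow> 'v \<Rightarrow> bool) \<Rightarrow> real \<Rightarrow> real" where
  "site_perc_prob V E p =
     (let S = (\<Pi>\<^sub>M v\<in>V. measure_pmf (bernoulli_pmf p))
      in measure S {\<omega> \<in> space S. percolates {v \<in> V. \<omega> v} E})"

definition site_critical_prob :: "'v set \<Rightarrow> ('v \<Rightarrow> 'v \<Rightarrow> bool) \<Rightarrow> real" where
  "site_critical_prob V E = Sup {p \<in> {0..1}. site_perc_prob V E p = 0}"

section \<open>The lattice quantities\<close>

text \<open>The plane is identified with the complex numbers; \<open>s\<close> is the edge length.\<close>

definition tri_lattice :: "real \<Rightarrow> complex set" where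
  "tri_lattice s = {of_real s * (of_int m + of_int n * cis (pi / 3)) |m n. True}"

definition tri_adj :: "real \<Rightarrow> complex \<Rightarrow> complex \<Rightarrow> bool" where
  "tri_adj s z w \<longleftrightarrow> dist z w = s"

definition flower :: "real \<Rightarrow> complex \<Rightarrow> complex set" where
  "flower s z = (\<Inter>w\<in>{w \<in> tri_lattice s. tri_adj s z w}. cball (midpoint z w) s)"

text \<open>\<open>\<int>\<^sup>d\<close> as extensional functions on \<open>{..<d}\<close>, with adjacency at sup-norm distance one.\<close>

definition int_lattice :: "nat \<Rightarrow> (nat \<Rightarrow> int) set" where
  "int_lattice d = {..<d} \<rightarrow>\<^sub>E UNIV"

definition linf_adj :: "nat \<Rightarrow> (nat \<Rightarrow> int) \<Rightarrow> (nat \<Rightarrow> int) \<Rightarrow> bool" where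
  "linf_adj d z w \<longleftrightarrow> (MAX i\<in>{..<d}. \<bar>z i - w i\<bar>) = 1"

text \<open>The critical probability of the triangular lattice does not depend on the edge length, which is
  taken to be one here. Likewise all flowers of a lattice are translates of each other, so that the
  one around the origin determines the area. Both functions are meant for \<open>d \<ge> 2\<close>.\<close>

definition p_c :: "nat \<Rightarrow> real" where
  "p_c d = (if d = 2 then site_critical_prob (tri_lattice 1) (tri_adj 1)
            else site_critical_prob (int_lattice d) (linf_adj d))"

definition cell_vol :: "nat \<Rightarrow> real \<Rightarrow> real" where
  "cell_vol d \<rho> = (if d = 2 then measure lborel (flower (\<rho> / 2) 0)
                   else (\<rho> / (2 * sqrt (real d))) ^ d)"

section \<open>Poisson point processes\<close>

text \<open>Homogeneous Poisson processes are simple, so point configurations are represented by locally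
  finite sets, with the sigma-algebra generated by the counts of points in bounded Borel sets.\<close>

definition locally_finite_set :: "'a::euclidean_space set \<Rightarrow> bool" where
  "locally_finite_set \<phi> \<longleftrightarrow> (\<forall>B. bounded B \<longrightarrow> finite (\<phi> \<inter> B))"

definition config_space :: "'a::euclidean_space set measure" where
  "config_space = sigma {\<phi>. locally_finite_set \<phi>}
     {{\<phi>. locally_finite_set \<phi> \<and> card (\<phi> \<inter> B) = k} |B k. B \<in> sets borel \<and> bounded B}"

definition poisson_process :: "'w measure \<Rightarrow> real \<Rightarrow> ('w \<Rightarrow> 'a::euclidean_space set) \<Rightarrow> bool" where
  "poisson_process M lam \<Phi> \<longleftrightarrow>
     \<Phi> \<in> measurable M config_space \<and>
     (\<forall>B k. B \<in> sets borel \<and> bounded B \<longrightarrow>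
        measure M {\<omega> \<in> space M. card (\<Phi> \<omega> \<inter> B) = k} =
          (lam * measure lborel B) ^ k / fact k * exp (- (lam * measure lborel B))) \<and>
     (\<forall>\<B>. finite \<B> \<and> disjoint \<B> \<and> (\<forall>B\<in>\<B>. B \<in> sets borel \<and> bounded B) \<longrightarrow>
        prob_space.indep_vars M (\<lambda>_. count_space UNIV) (\<lambda>B \<omega>. card (\<Phi> \<omega> \<inter> B)) \<B>)"

definition indep_poisson_processes ::
    "'w measure \<Rightarrow> real \<Rightarrow> real \<Rightarrow> ('w \<Rightarrow> 'a::euclidean_space set) \<Rightarrow> ('w \<Rightarrow> 'a set) \<Rightarrow> bool" where
  "indep_poisson_processes M lam \<mu> \<Phi>1 \<Phi>2 \<longleftrightarrow>
     prob_space M \<and> poisson_process M lam \<Phi>1 \<and> poisson_process M \<mu> \<Phi>2 \<and>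
     prob_space.indep_var M config_space \<Phi>1 config_space \<Phi>2"

section \<open>Continuum AB percolation\<close>

definition AB_adj :: "'a::euclidean_space set \<Rightarrow> real \<Rightarrow> 'a \<Rightarrow> 'a \<Rightarrow> bool" where
  "AB_adj \<psi> r x x' \<longleftrightarrow> x \<noteq> x' \<and> (\<exists>y\<in>\<psi>. dist x y \<le> 2 * r \<and> dist x' y \<le> 2 * r)"

definition AB_perc_prob ::
    "'w measure \<Rightarrow> ('w \<Rightarrow> 'a::euclidean_space set) \<Rightarrow> ('w \<Rightarrow> 'a set) \<Rightarrow> real \<Rightarrow> real" where
  "AB_perc_prob M \<Phi>1 \<Phi>2 r = measure M {\<omega> \<in> space M. percolates (\<Phi>1 \<omega>) (AB_adj (\<Phi>2 \<omega>) r)}"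

text \<open>The first three arguments provide, for every second intensity \<open>\<mu>\<close>, a probability space and a pair of
  independent Poisson processes of intensities \<open>lam\<close> and \<open>\<mu>\<close>; the result depends on their laws only.
  The supremum may be infinite and is therefore taken in \<open>[0, \<infinity>]\<close>.\<close>

definition mu_c ::
    "(real \<Rightarrow> 'w measure) \<Rightarrow> (real \<Rightarrow> 'w \<Rightarrow> 'a::euclidean_space set) \<Rightarrow> (real \<Rightarrow> 'w \<Rightarrow> 'a set) \<Rightarrow>
     real \<Rightarrow> ennreal" where
  "mu_c M \<Phi>1 \<Phi>2 r = Sup {ennreal \<mu> |\<mu>. \<mu> > 0 \<and> AB_perc_prob (M \<mu>) (\<Phi>1 \<mu>) (\<Phi>2 \<mu>) r = 0}"

end

theory Submission
  imports Defs
begin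

text \<open>
  Place disjoint cells of volume \<open>a\<close> around the lattice sites: flowers minus the lattice midpoints for
  \<open>d = 2\<close>, half-open cubes of side \<open>r / \<surd>d\<close> for \<open>d \<ge> 3\<close>. Points in equal or adjacent cells are within
  distance \<open>2 * r\<close>. Call a site open if its cell meets both processes. The open sites form Bernoulli
  site percolation with \<open>q = (1 - exp (- lam * a)) * (1 - exp (- \<mu> * a))\<close>, and an infinite open cluster
  yields an infinite cluster of the AB graph, so \<open>q > p_c\<close> excludes \<open>\<theta> = 0\<close>.

  That \<open>p_c < 1\<close> is shown by renormalisation on the quadrant \<open>\<nat>\<^sup>2\<close>, embedded in either lattice:
  a block of \<open>3 \<times> 3\<close> sub-blocks is good if at most one of them is bad. The good sub-blocks of adjacent
  good blocks are connected to each other, and the probability \<open>e\<^sub>n\<close> that a level-\<open>n\<close> block is bad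
  satisfies \<open>e\<^bsub>n+1\<^esub> \<le> 81 * e\<^sub>n\<^sup>2\<close>.
\<close>

section \<open>Percolation and graph maps\<close>

text \<open>The bound is the value of \<open>\<mu>\<close> that solves \<open>q = p_c\<close>, and
  the hypothesis on \<open>lam\<close> says that \<open>p_c < 1 - exp (- lam * a)\<close>, so that
  such a \<open>\<mu>\<close> exists. This reading needs \<open>p_c < 1\<close>, because
  \<open>ln 0\<close> is a mere convention that would empty the hypothesis of its meaning; hence the
  renormalisation. Bad blocks are controlled by a union bound: a bad block of level \<open>n\<close>
  has one of at most \<open>81 ^ (2 ^ n) / 81\<close> prescribed sets of \<open>2 ^ n\<close> sites
  entirely closed. The number 81 = 9 * 9 bounds the ordered pairs of sub-blocks, and a closing
  probability of at most 1 / 162 = 1 / (2 * 81) makes the bounds sum to at most 1 / 81. The other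
  obstacle is measurability: the configuration space only sees counts in fixed bounded Borel sets,
  whereas percolation quantifies over the points of a random set. Such quantifiers are reduced to
  counts in sections of product-measurable sets, and clusters to countably many statements about
  paths of fixed length.\<close>

lemma percolates_iff:
  "percolates V E \<longleftrightarrow> (\<exists>v\<in>V. infinite ({(u, v). u \<in> V \<and> v \<in> V \<and> E u v}\<^sup>* `` {v}))"
  by (auto simp: percolates_def components_def quotient_def)

text \<open>Clusters map into clusters, and injectivity keeps the image infinite. Used for the
  embedding of the quadrant in a lattice and for the choice of one point in each open cell.\<close>

lemma percolates_map:
  assumes perc: "percolates W E" and inj: "inj_on f W" and sub: "f ` W \<subseteq> W'"
    and adj: "\<And>u v. u \<in> W \<Longrightarrow> v \<in> W \<Longrightarrow> E u v \<Longrightarrow> E' (f u) (f v)"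
  shows "percolates W' E'"
proof -
  define R where "R = {(u, v). u \<in> W \<and> v \<in> W \<and> E u v}"
  define R' where "R' = {(u, v). u \<in> W' \<and> v \<in> W' \<and> E' u v}"
  obtain w where w: "w \<in> W" and inf: "infinite (R\<^sup>* `` {w})"
    using perc unfolding percolates_iff R_def by blast
  have step: "u \<in> W \<and> (f w, f u) \<in> R'\<^sup>*" if "(w, u) \<in> R\<^sup>*" for u
    using that
  proof induction
    case base
    then show ?case using w by simp
  next
    case (step y z)
    then have "(f y, f z) \<in> R'"
      using sub adj by (auto simp: R_def R'_def)
    with step show ?case by (auto simp: R_def intro: rtrancl_into_rtrancl)
  qed
  have "R\<^sup>* `` {w} \<subseteq> W" using step by blast
  then have "inj_on f (R\<^sup>* `` {w})" using inj inj_on_subset by blast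
  then have "infinite (f ` (R\<^sup>* `` {w}))" using inf finite_imageD by blast
  moreover have "f ` (R\<^sup>* `` {w}) \<subseteq> R'\<^sup>* `` {f w}" using step by blast
  ultimately have "infinite (R'\<^sup>* `` {f w})" using infinite_super by blast
  then show ?thesis
    unfolding percolates_iff using w sub by (auto simp: R'_def)
qed

text \<open>Paths of exactly \<open>n\<close> steps, in place of a transitive closure, let
  measurability go by induction on \<open>n\<close> and a countable union. All vertices but the last
  are required to lie in \<open>V\<close>.\<close>

fun reach :: "'v set \<Rightarrow> ('v \<Rightarrow> 'v \<Rightarrow> bool) \<Rightarrow> nat \<Rightarrow> 'v \<Rightarrow> 'v \<Rightarrow> bool" where
  "reach V E 0 x y \<longleftrightarrow> x = y"
| "reach V E (Suc n) x y \<longleftrightarrow> (\<exists>z\<in>V. E z y \<and> reach V E n x z)"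

lemma reach_iff_rtrancl:
  assumes "x \<in> V"
  shows "(x, y) \<in> {(u, v). u \<in> V \<and> v \<in> V \<and> E u v}\<^sup>* \<longleftrightarrow> y \<in> V \<and> (\<exists>n. reach V E n x y)"
    (is "_ \<in> ?R\<^sup>* \<longleftrightarrow> _")
proof
  assume "(x, y) \<in> ?R\<^sup>*"
  then show "y \<in> V \<and> (\<exists>n. reach V E n x y)"
  proof induction
    case base
    show ?case using assms by (auto intro: exI[of _ 0])
  next
    case (step y z)
    then obtain n where "reach V E n x y" by blast
    then have "reach V E (Suc n) x z" using step by auto
    then show ?case using step by blast
  qed
next
  have "y \<in> V \<Longrightarrow> reach V E n x y \<Longrightarrow> (x, y) \<in> ?R\<^sup>*" for n
    by (induction n arbitrary: y) (auto intro: rtrancl_into_rtrancl)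
  then show "y \<in> V \<and> (\<exists>n. reach V E n x y) \<Longrightarrow> (x, y) \<in> ?R\<^sup>*" by blast
qed

section \<open>Measurability of AB percolation\<close>

lemma locally_finite_setD: "locally_finite_set \<phi> \<Longrightarrow> bounded B \<Longrightarrow> finite (\<phi> \<inter> B)"
  by (simp add: locally_finite_set_def)

lemma space_config_space [simp]: "space config_space = {\<phi>. locally_finite_set \<phi>}"
  unfolding config_space_def by (rule space_measure_of) auto

lemma config_space_count_sets:
  assumes "B \<in> sets borel" "bounded B"
  shows "{\<phi>. locally_finite_set \<phi> \<and> card (\<phi> \<inter> B) = k} \<in> sets config_space"
  unfolding config_space_def using assms
  by (subst sets_measure_of) auto

lemma measurable_config_count [measurable (raw)]:
  assumes \<Phi>: "\<Phi> \<in> measurable M config_space" and B: "B \<in> sets borel" "bounded B"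
  shows "(\<lambda>\<omega>. card (\<Phi> \<omega> \<inter> B)) \<in> measurable M (count_space UNIV)"
proof (rule measurable_compose[OF \<Phi>])
  show "(\<lambda>\<phi>. card (\<phi> \<inter> B)) \<in> measurable config_space (count_space UNIV)"
  proof (subst measurable_count_space_eq2_countable)
    show "(\<lambda>\<phi>. card (\<phi> \<inter> B)) \<in> space config_space \<rightarrow> UNIV \<and>
      (\<forall>a\<in>UNIV. (\<lambda>\<phi>. card (\<phi> \<inter> B)) -` {a} \<inter> space config_space \<in> sets config_space)"
    proof (intro conjI ballI)
      fix k
      have "(\<lambda>\<phi>. card (\<phi> \<inter> B)) -` {k} \<inter> space config_space
         = {\<phi>. locally_finite_set \<phi> \<and> card (\<phi> \<inter> B) = k}" by auto
      then show "(\<lambda>\<phi>. card (\<phi> \<inter> B)) -` {k} \<inter> space config_space \<in> sets config_space"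
        using config_space_count_sets[OF B] by simp
    qed simp
  qed
qed

text \<open>Dynkin's argument lifts counts in fixed sets to counts in sections that vary with
  \<open>\<omega>\<close>: a rectangle gives an indicator times a count, a complement a difference,
  a disjoint union a series. Boundedness of \<open>B\<close> keeps the counts finite, so that the
  difference is meaningful.\<close>

lemma measurable_config_card_section:
  fixes \<Phi> :: "'w \<Rightarrow> 'a::euclidean_space set"
  assumes \<Phi>: "\<Phi> \<in> measurable M config_space" and B: "B \<in> sets borel" "bounded B"
    and A: "A \<in> sets (M \<Otimes>\<^sub>M borel)"
  shows "(\<lambda>\<omega>. real (card {x \<in> \<Phi> \<omega> \<inter> B. (\<omega>, x) \<in> A})) \<in> borel_measurable M"
proof -
  have lf: "locally_finite_set (\<Phi> \<omega>)" if "\<omega> \<in> space M" for \<omega>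
    using measurable_space[OF \<Phi> that] by simp
  have fin: "finite (\<Phi> \<omega> \<inter> B)" if "\<omega> \<in> space M" for \<omega>
    using locally_finite_setD[OF lf[OF that] B(2)] .
  have "A \<in> sigma_sets (space M \<times> space borel) {a \<times> b | a b. a \<in> sets M \<and> b \<in> sets borel}"
    using A unfolding sets_pair_measure .
  with Int_stable_pair_measure_generator pair_measure_closed show ?thesis
  proof (induction rule: sigma_sets_induct_disjoint)
    case (basic A)
    then obtain a b where ab: "A = a \<times> b" "a \<in> sets M" "b \<in> sets borel" by auto
    have "(\<lambda>\<omega>. indicator a \<omega> * real (card (\<Phi> \<omega> \<inter> (B \<inter> b)))) \<in> borel_measurable M"
      using ab B by (intro borel_measurable_times borel_measurable_indicator
        measurable_compose[OF measurable_config_count[OF \<Phi>]]) (auto intro: bounded_subset)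
    also have "?this \<longleftrightarrow> ?case"
      by (intro measurable_cong) (auto simp: ab indicator_def intro!: arg_cong[of _ _ card])
    finally show ?case .
  next
    case empty
    then show ?case by simp
  next
    case (compl A)
    have "(\<lambda>\<omega>. real (card (\<Phi> \<omega> \<inter> B)) - real (card {x \<in> \<Phi> \<omega> \<inter> B. (\<omega>, x) \<in> A})) \<in> borel_measurable M"
      using compl.IH B by (intro borel_measurable_diff measurable_compose[OF measurable_config_count[OF \<Phi>]]) auto
    also have "?this \<longleftrightarrow> ?case"
    proof (intro measurable_cong)
      fix \<omega> assume \<omega>: "\<omega> \<in> space M"
      have "{x \<in> \<Phi> \<omega> \<inter> B. (\<omega>, x) \<in> space M \<times> space borel - A} = \<Phi> \<omega> \<inter> B - {x \<in> \<Phi> \<omega> \<inter> B. (\<omega>, x) \<in> A}"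
        using \<omega> by auto
      moreover have finS: "finite {x \<in> \<Phi> \<omega> \<inter> B. (\<omega>, x) \<in> A}"
        by (rule finite_subset[OF _ fin[OF \<omega>]]) auto
      moreover have "card (\<Phi> \<omega> \<inter> B - {x \<in> \<Phi> \<omega> \<inter> B. (\<omega>, x) \<in> A})
         = card (\<Phi> \<omega> \<inter> B) - card {x \<in> \<Phi> \<omega> \<inter> B. (\<omega>, x) \<in> A}"
        by (rule card_Diff_subset[OF finS]) auto
      moreover have "card {x \<in> \<Phi> \<omega> \<inter> B. (\<omega>, x) \<in> A} \<le> card (\<Phi> \<omega> \<inter> B)"
        by (rule card_mono) (use fin[OF \<omega>] in auto)
      ultimately show "real (card (\<Phi> \<omega> \<inter> B)) - real (card {x \<in> \<Phi> \<omega> \<inter> B. (\<omega>, x) \<in> A})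
        = real (card {x \<in> \<Phi> \<omega> \<inter> B. (\<omega>, x) \<in> space M \<times> space borel - A})"
        by (simp add: of_nat_diff)
    qed
    finally show ?case .
  next
    case (union A)
    have "(\<lambda>\<omega>. \<Sum>i. real (card {x \<in> \<Phi> \<omega> \<inter> B. (\<omega>, x) \<in> A i})) \<in> borel_measurable M"
      using union.IH by (rule borel_measurable_suminf)
    also have "?this \<longleftrightarrow> ?case"
    proof (intro measurable_cong)
      fix \<omega> assume \<omega>: "\<omega> \<in> space M"
      let ?S = "\<lambda>i. {x \<in> \<Phi> \<omega> \<inter> B. (\<omega>, x) \<in> A i}"
      have disj: "disjoint_family ?S"
        using union(1) unfolding disjoint_family_on_def by blast
      have U: "{x \<in> \<Phi> \<omega> \<inter> B. (\<omega>, x) \<in> (\<Union>i. A i)} = (\<Union>i. ?S i)" by auto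
      have fU: "finite (\<Union>i. ?S i)" by (rule finite_subset[OF _ fin[OF \<omega>]]) auto
      let ?C = "count_space (\<Phi> \<omega> \<inter> B)"
      interpret finite_measure ?C using fin[OF \<omega>] by (rule finite_measure_count_space)
      have "(\<lambda>i. measure ?C (?S i)) sums measure ?C (\<Union>i. ?S i)"
        by (rule finite_measure_UNION) (use disj in auto)
      moreover have "measure ?C S = real (card S)" if "S \<subseteq> \<Phi> \<omega> \<inter> B" for S
        using fin[OF \<omega>] finite_subset[OF that] that by (simp add: measure_count_space)
      ultimately have "(\<lambda>i. real (card (?S i))) sums real (card (\<Union>i. ?S i))"
        by (simp add: Collect_subset UN_least subset_eq)
      then show "(\<Sum>i. real (card (?S i))) = real (card {x \<in> \<Phi> \<omega> \<inter> B. (\<omega>, x) \<in> (\<Union>i. A i)})"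
        unfolding U by (rule sums_unique[symmetric])
    qed
    finally show ?case .
  qed
qed

text \<open>A witness in the random set shows up as a positive count of the section in some ball
  around 0. This replaces a quantifier over random points by a countable one over radii.\<close>

lemma pred_Bex_config [measurable (raw)]:
  fixes \<Phi> :: "'w \<Rightarrow> 'a::euclidean_space set"
  assumes \<Phi>: "\<Phi> \<in> measurable M config_space"
    and P: "Measurable.pred (M \<Otimes>\<^sub>M borel) (\<lambda>(\<omega>, x). P \<omega> x)"
  shows "Measurable.pred M (\<lambda>\<omega>. \<exists>x\<in>\<Phi> \<omega>. P \<omega> x)"
proof -
  let ?A = "{z \<in> space (M \<Otimes>\<^sub>M borel). P (fst z) (snd z)}"
  have A: "?A \<in> sets (M \<Otimes>\<^sub>M borel)" using P by (simp add: pred_def case_prod_beta)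
  have "Measurable.pred M (\<lambda>\<omega>. \<exists>n::nat. real (card {x \<in> \<Phi> \<omega> \<inter> cball 0 (real n). (\<omega>, x) \<in> ?A}) > 0)"
    using measurable_config_card_section[OF \<Phi> _ _ A, of "cball 0 (real _)"]
    by measurable
  also have "?this \<longleftrightarrow> ?thesis"
  proof (intro measurable_cong)
    fix \<omega> assume \<omega>: "\<omega> \<in> space M"
    have lf: "locally_finite_set (\<Phi> \<omega>)"
      using measurable_space[OF \<Phi> \<omega>] by simp
    have "real (card {x \<in> \<Phi> \<omega> \<inter> cball 0 (real n). (\<omega>, x) \<in> ?A}) > 0
      \<longleftrightarrow> (\<exists>x\<in>\<Phi> \<omega>. norm x \<le> real n \<and> P \<omega> x)" for n
    proof -
      have "finite {x \<in> \<Phi> \<omega> \<inter> cball 0 (real n). (\<omega>, x) \<in> ?A}"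
        by (rule finite_subset[OF _ locally_finite_setD[OF lf bounded_cball[of 0 "real n"]]]) auto
      then show ?thesis using \<omega> by (auto simp: card_gt_0_iff space_pair_measure)
    qed
    then have "(\<exists>n::nat. real (card {x \<in> \<Phi> \<omega> \<inter> cball 0 (real n). (\<omega>, x) \<in> ?A}) > 0)
      \<longleftrightarrow> (\<exists>n::nat. \<exists>x\<in>\<Phi> \<omega>. norm x \<le> real n \<and> P \<omega> x)" by (simp only:)
    also have "\<dots> \<longleftrightarrow> (\<exists>x\<in>\<Phi> \<omega>. P \<omega> x)"
      using real_arch_simple[of "norm _"] by (metis (no_types))
    finally show "(\<exists>n::nat. real (card {x \<in> \<Phi> \<omega> \<inter> cball 0 (real n). (\<omega>, x) \<in> ?A}) > 0)
      \<longleftrightarrow> (\<exists>x\<in>\<Phi> \<omega>. P \<omega> x)" .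
  qed
  finally show ?thesis .
qed

text \<open>Bounded pieces of a locally finite set are finite. The form with integer radii expresses
  that a cluster is infinite by a countable quantifier.\<close>

lemma infinite_locally_finite_iff:
  assumes "locally_finite_set \<phi>" "S \<subseteq> \<phi>"
  shows "infinite S \<longleftrightarrow> (\<forall>k::nat. \<exists>x\<in>S. norm x > real k)"
proof
  assume inf: "infinite S"
  show "\<forall>k::nat. \<exists>x\<in>S. norm x > real k"
  proof (rule ccontr)
    assume "\<not> ?thesis"
    then obtain k :: nat where "\<forall>x\<in>S. norm x \<le> real k" by (auto simp: not_less)
    then have "S \<subseteq> \<phi> \<inter> cball 0 (real k)" using assms by auto
    then show False using inf assms locally_finite_setD[OF assms(1) bounded_cball] finite_subset by blast
  qed
next
  assume unb: "\<forall>k::nat. \<exists>x\<in>S. norm x > real k"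
  show "infinite S"
  proof
    assume "finite S"
    then obtain b where "\<forall>x\<in>S. norm x \<le> b" using finite_imp_bounded bounded_iff by metis
    moreover obtain k :: nat where "b \<le> real k" using real_arch_simple by blast
    ultimately show False using unb by (metis dual_order.trans not_less)
  qed
qed

lemma pred_AB_adj [measurable (raw)]:
  fixes \<Psi> :: "'w \<Rightarrow> 'a::euclidean_space set"
  assumes \<Psi>: "\<Psi> \<in> measurable M config_space"
    and [measurable]: "f \<in> borel_measurable M" "g \<in> borel_measurable M"
  shows "Measurable.pred M (\<lambda>\<omega>. AB_adj (\<Psi> \<omega>) r (f \<omega>) (g \<omega>))"
proof -
  have "Measurable.pred M (\<lambda>\<omega>. \<exists>y\<in>\<Psi> \<omega>. dist (f \<omega>) y \<le> 2 * r \<and> dist (g \<omega>) y \<le> 2 * r)"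
    by (rule pred_Bex_config[OF \<Psi>]) measurable
  moreover have "Measurable.pred M (\<lambda>\<omega>. dist (f \<omega>) (g \<omega>) \<noteq> 0)" by measurable
  ultimately show ?thesis unfolding AB_adj_def by simp
qed

text \<open>The endpoints are coordinates of the product space because the induction step lets the
  last intermediate vertex run through \<open>\<Phi> \<omega>\<close>, and
  \<open>pred_Bex_config\<close> asks for joint measurability in that vertex.\<close>

lemma pred_reach:
  fixes \<Phi> :: "'w \<Rightarrow> 'a::euclidean_space set"
  assumes \<Phi>: "\<Phi> \<in> measurable M config_space"
    and E: "Measurable.pred ((M \<Otimes>\<^sub>M borel) \<Otimes>\<^sub>M borel) (\<lambda>((\<omega>, x), y). E \<omega> x y)"
  shows "Measurable.pred ((M \<Otimes>\<^sub>M borel) \<Otimes>\<^sub>M borel) (\<lambda>((\<omega>, x), y). reach (\<Phi> \<omega>) (E \<omega>) n x y)"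
proof (induction n)
  case 0
  have "Measurable.pred ((M \<Otimes>\<^sub>M borel) \<Otimes>\<^sub>M borel) (\<lambda>w. dist (snd (fst w)) (snd w :: 'a) = 0)" by measurable
  then show ?case by (simp add: case_prod_beta)
next
  case (Suc n)
  let ?N = "((M \<Otimes>\<^sub>M borel) \<Otimes>\<^sub>M borel) :: (('w \<times> 'a) \<times> 'a) measure"
  have "Measurable.pred ?N (\<lambda>w. \<exists>z\<in>\<Phi> (fst (fst w)).
      E (fst (fst w)) z (snd w) \<and> reach (\<Phi> (fst (fst w))) (E (fst (fst w))) n (snd (fst w)) z)"
  proof (rule pred_Bex_config)
    show "(\<lambda>w. \<Phi> (fst (fst w))) \<in> measurable ?N config_space" using \<Phi> by measurable
    \<comment> \<open>Coordinates are rearranged: the new vertex is first the start of the last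
      edge, then the end of the shorter path.\<close>
    have "(\<lambda>w. ((fst (fst (fst w)), snd w), snd (fst w))) \<in> measurable (?N \<Otimes>\<^sub>M borel) ?N"
      by measurable
    from measurable_compose[OF this E]
    have "Measurable.pred (?N \<Otimes>\<^sub>M borel) (\<lambda>w. E (fst (fst (fst w))) (snd w) (snd (fst w)))"
      by (simp add: case_prod_beta)
    moreover have "(\<lambda>w. ((fst (fst (fst w)), snd (fst (fst w))), snd w)) \<in> measurable (?N \<Otimes>\<^sub>M borel) ?N"
      by measurable
    from measurable_compose[OF this Suc.IH]
    have "Measurable.pred (?N \<Otimes>\<^sub>M borel) (\<lambda>w. reach (\<Phi> (fst (fst (fst w)))) (E (fst (fst (fst w)))) n
        (snd (fst (fst w))) (snd w))"
      by (simp add: case_prod_beta)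
    ultimately show "Measurable.pred (?N \<Otimes>\<^sub>M borel) (\<lambda>(w, z). E (fst (fst w)) z (snd w) \<and>
        reach (\<Phi> (fst (fst w))) (E (fst (fst w))) n (snd (fst w)) z)"
      by (simp add: case_prod_beta)
  qed
  then show ?case by (simp add: case_prod_beta)
qed

text \<open>Needed because \<open>AB_perc_prob\<close> would be \<open>0\<close> by convention on a non-measurable event.\<close>

lemma pred_AB_percolates:
  fixes \<Phi> \<Psi> :: "'w \<Rightarrow> 'a::euclidean_space set"
  assumes \<Phi>: "\<Phi> \<in> measurable M config_space" and \<Psi>: "\<Psi> \<in> measurable M config_space"
  shows "Measurable.pred M (\<lambda>\<omega>. percolates (\<Phi> \<omega>) (AB_adj (\<Psi> \<omega>) r))"
proof -
  have "(\<lambda>w. \<Psi> (fst (fst w))) \<in> measurable ((M \<Otimes>\<^sub>M borel) \<Otimes>\<^sub>M borel) config_space"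
    using \<Psi> by measurable
  then have E: "Measurable.pred ((M \<Otimes>\<^sub>M borel) \<Otimes>\<^sub>M borel) (\<lambda>((\<omega>, x), y). AB_adj (\<Psi> \<omega>) r x y)"
    unfolding case_prod_beta by (rule pred_AB_adj) measurable
  have "Measurable.pred M (\<lambda>\<omega>. \<exists>x\<in>\<Phi> \<omega>. \<forall>k::nat. \<exists>y\<in>\<Phi> \<omega>. norm y > real k \<and>
      (\<exists>n. reach (\<Phi> \<omega>) (AB_adj (\<Psi> \<omega>) r) n x y))"
  proof (rule pred_Bex_config[OF \<Phi>], unfold case_prod_beta, rule pred_intros_countable(1), rule pred_Bex_config)
    show "(\<lambda>w. \<Phi> (fst w)) \<in> measurable (M \<Otimes>\<^sub>M borel) config_space" using \<Phi> by measurable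
    fix k :: nat
    have [measurable]: "Measurable.pred ((M \<Otimes>\<^sub>M borel) \<Otimes>\<^sub>M borel)
      (\<lambda>w. \<exists>n. reach (\<Phi> (fst (fst w))) (AB_adj (\<Psi> (fst (fst w))) r) n (snd (fst w)) (snd w))"
      using pred_reach[OF \<Phi> E] unfolding case_prod_beta by (rule pred_intros_countable(2))
    show "Measurable.pred ((M \<Otimes>\<^sub>M borel) \<Otimes>\<^sub>M borel) (\<lambda>(w, y). real k < norm y \<and>
      (\<exists>n. reach (\<Phi> (fst w)) (AB_adj (\<Psi> (fst w)) r) n (snd w) y))"
      unfolding case_prod_beta by measurable
  qed
  also have "?this \<longleftrightarrow> ?thesis"
  proof (intro measurable_cong)
    fix \<omega> assume "\<omega> \<in> space M"
    then have lf: "locally_finite_set (\<Phi> \<omega>)" using measurable_space[OF \<Phi>] by auto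
    let ?E = "AB_adj (\<Psi> \<omega>) r"
    let ?R = "{(u, v). u \<in> \<Phi> \<omega> \<and> v \<in> \<Phi> \<omega> \<and> ?E u v}"
    have "infinite (?R\<^sup>* `` {x}) \<longleftrightarrow> (\<forall>k::nat. \<exists>y\<in>\<Phi> \<omega>. norm y > real k \<and> (\<exists>n. reach (\<Phi> \<omega>) ?E n x y))"
      if x: "x \<in> \<Phi> \<omega>" for x
    proof -
      have eq: "?R\<^sup>* `` {x} = {y \<in> \<Phi> \<omega>. \<exists>n. reach (\<Phi> \<omega>) ?E n x y}"
        using reach_iff_rtrancl[OF x] by auto
      have sub: "{y \<in> \<Phi> \<omega>. \<exists>n. reach (\<Phi> \<omega>) ?E n x y} \<subseteq> \<Phi> \<omega>" by blast
      show ?thesis unfolding eq infinite_locally_finite_iff[OF lf sub] by blast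
    qed
    then show "(\<exists>x\<in>\<Phi> \<omega>. \<forall>k::nat. \<exists>y\<in>\<Phi> \<omega>. norm y > real k \<and> (\<exists>n. reach (\<Phi> \<omega>) ?E n x y))
      \<longleftrightarrow> percolates (\<Phi> \<omega>) ?E"
      unfolding percolates_iff by blast
  qed
  finally show ?thesis .
qed

section \<open>Sites hit by both processes\<close>

lemma poisson_process_measurable: "poisson_process M lam \<Phi> \<Longrightarrow> \<Phi> \<in> measurable M config_space"
  by (simp add: poisson_process_def)

lemma poisson_process_locally_finite:
  "poisson_process M lam \<Phi> \<Longrightarrow> \<omega> \<in> space M \<Longrightarrow> locally_finite_set (\<Phi> \<omega>)"
  using measurable_space[of \<Phi> M config_space \<omega>] by (simp add: poisson_process_measurable)

lemma hits_sets:
  assumes "B \<in> sets borel" "bounded B"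
  shows "{\<phi> \<in> space config_space. \<phi> \<inter> B \<noteq> {}} \<in> sets config_space"
proof -
  \<comment> \<open>\<open>card\<close> is 0 on infinite sets too, but a configuration meets a
    bounded set in finitely many points.\<close>
  have "{\<phi> \<in> space config_space. \<phi> \<inter> B \<noteq> {}}
      = space config_space - {\<phi>. locally_finite_set \<phi> \<and> card (\<phi> \<inter> B) = 0}"
    using locally_finite_setD[OF _ assms(2)] by auto
  also have "\<dots> \<in> sets config_space"
    using config_space_count_sets[OF assms] by blast
  finally show ?thesis .
qed

lemma poisson_process_hits:
  fixes \<Phi> :: "'w \<Rightarrow> 'a::euclidean_space set"
  assumes M: "prob_space M" and \<Phi>: "poisson_process M lam \<Phi>"
    and fin: "finite J" and disj: "disjoint_family_on c J"
    and c: "\<And>v. v \<in> J \<Longrightarrow> c v \<in> sets borel" "\<And>v. v \<in> J \<Longrightarrow> bounded (c v)"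
      "\<And>v. v \<in> J \<Longrightarrow> measure lborel (c v) = a" and a: "a > 0"
  shows "measure M {\<omega> \<in> space M. \<forall>v\<in>J. \<Phi> \<omega> \<inter> c v \<noteq> {}} = (1 - exp (- lam * a)) ^ card J"
proof (cases "J = {}")
  case True
  then show ?thesis using prob_space.prob_space[OF M] by simp
next
  case False
  interpret prob_space M by fact
  let ?N = "\<lambda>B \<omega>. card (\<Phi> \<omega> \<inter> B)"
  \<comment> \<open>Independence of counts is stated for a set of regions, so cells with different
    indices must be different sets: positive volume makes them nonempty, and disjointness does the
    rest.\<close>
  have ne: "c v \<noteq> {}" if "v \<in> J" for v using c(3)[OF that] a by auto
  have inj: "inj_on c J"
  proof (rule inj_onI, rule ccontr)
    fix u v assume "u \<in> J" "v \<in> J" "c u = c v" "u \<noteq> v"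
    then show False using disj ne[of u] by (auto simp: disjoint_family_on_def)
  qed
  have "disjoint (c ` J)" using disj by (rule disjoint_family_on_disjoint_image)
  then have ind: "indep_vars (\<lambda>_. count_space UNIV) ?N (c ` J)"
    using \<Phi> fin c unfolding poisson_process_def by auto
  have hit: "\<Phi> \<omega> \<inter> B \<noteq> {} \<longleftrightarrow> ?N B \<omega> \<noteq> 0" if "\<omega> \<in> space M" "bounded B" for \<omega> B
    using locally_finite_setD[OF poisson_process_locally_finite[OF \<Phi> that(1)] that(2)] by auto
  have one: "prob (?N (c v) -` (- {0}) \<inter> space M) = 1 - exp (- lam * a)" if v: "v \<in> J" for v
  proof -
    have rv: "random_variable (count_space UNIV) (?N (c v))"
      using measurable_config_count[OF poisson_process_measurable[OF \<Phi>] c(1)[OF v] c(2)[OF v]] .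
    then have "{\<omega> \<in> space M. ?N (c v) \<omega> = 0} \<in> events" by measurable
    then have "prob (space M - {\<omega> \<in> space M. ?N (c v) \<omega> = 0}) = 1 - prob {\<omega> \<in> space M. ?N (c v) \<omega> = 0}"
      by (rule prob_compl)
    moreover have "prob {\<omega> \<in> space M. ?N (c v) \<omega> = 0} = exp (- lam * a)"
      using \<Phi> c[OF v] unfolding poisson_process_def by simp
    moreover have "space M - {\<omega> \<in> space M. ?N (c v) \<omega> = 0} = ?N (c v) -` (- {0}) \<inter> space M" by auto
    ultimately show ?thesis by simp
  qed
  have "{\<omega> \<in> space M. \<forall>v\<in>J. \<Phi> \<omega> \<inter> c v \<noteq> {}} = (\<Inter>B\<in>c ` J. ?N B -` (- {0}) \<inter> space M)"
    using False hit c(2) by auto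
  then have "prob {\<omega> \<in> space M. \<forall>v\<in>J. \<Phi> \<omega> \<inter> c v \<noteq> {}} = (\<Prod>B\<in>c ` J. prob (?N B -` (- {0}) \<inter> space M))"
    using indep_varsD_finite[OF ind, of "\<lambda>_. - {0}"] False fin by simp
  also have "\<dots> = (\<Prod>v\<in>J. 1 - exp (- lam * a))"
    unfolding prod.reindex[OF inj] o_def by (rule prod.cong[OF refl one])
  finally show ?thesis by simp
qed

section \<open>The random field of cells met by both processes\<close>

definition both_hit :: "('w \<Rightarrow> 'a set) \<Rightarrow> ('w \<Rightarrow> 'a set) \<Rightarrow> 'a set \<Rightarrow> 'w \<Rightarrow> bool" where
  "both_hit \<Phi> \<Psi> B \<omega> \<longleftrightarrow> \<Phi> \<omega> \<inter> B \<noteq> {} \<and> \<Psi> \<omega> \<inter> B \<noteq> {}"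

text \<open>Independence of the two processes is applied once, to the events that each hits all
  cells of \<open>J\<close>; independence between cells comes from each process separately.\<close>

lemma both_hit_prob:
  fixes \<Phi> \<Psi> :: "'w \<Rightarrow> 'a::euclidean_space set"
  assumes PP: "indep_poisson_processes M lam \<mu> \<Phi> \<Psi>"
    and fin: "finite J" and disj: "disjoint_family_on c J"
    and c: "\<And>v. v \<in> J \<Longrightarrow> c v \<in> sets borel" "\<And>v. v \<in> J \<Longrightarrow> bounded (c v)"
      "\<And>v. v \<in> J \<Longrightarrow> measure lborel (c v) = a" and a: "a > 0"
  shows "measure M {\<omega> \<in> space M. \<forall>v\<in>J. both_hit \<Phi> \<Psi> (c v) \<omega>}
    = ((1 - exp (- lam * a)) * (1 - exp (- \<mu> * a))) ^ card J"
proof -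
  have M: "prob_space M" and \<Phi>: "poisson_process M lam \<Phi>" and \<Psi>: "poisson_process M \<mu> \<Psi>"
    and ind: "prob_space.indep_var M config_space \<Phi> config_space \<Psi>"
    using PP by (auto simp: indep_poisson_processes_def)
  interpret prob_space M by fact
  let ?H = "{\<phi> \<in> space config_space. \<forall>v\<in>J. \<phi> \<inter> c v \<noteq> {}}"
  have "?H \<in> sets config_space"
    using fin hits_sets c by (intro sets.sets_Collect_finite_All) auto
  then have "prob ((\<lambda>\<omega>. (\<Phi> \<omega>, \<Psi> \<omega>)) -` (?H \<times> ?H) \<inter> space M)
      = prob (\<Phi> -` ?H \<inter> space M) * prob (\<Psi> -` ?H \<inter> space M)"
    by (intro indep_varD[OF ind])
  moreover have "(\<lambda>\<omega>. (\<Phi> \<omega>, \<Psi> \<omega>)) -` (?H \<times> ?H) \<inter> space M = {\<omega> \<in> space M. \<forall>v\<in>J. both_hit \<Phi> \<Psi> (c v) \<omega>}"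
    "\<Phi> -` ?H \<inter> space M = {\<omega> \<in> space M. \<forall>v\<in>J. \<Phi> \<omega> \<inter> c v \<noteq> {}}"
    "\<Psi> -` ?H \<inter> space M = {\<omega> \<in> space M. \<forall>v\<in>J. \<Psi> \<omega> \<inter> c v \<noteq> {}}"
    using poisson_process_locally_finite[OF \<Phi>] poisson_process_locally_finite[OF \<Psi>]
    by (auto simp: both_hit_def)
  ultimately show ?thesis
    using poisson_process_hits[OF M \<Phi> fin disj c a] poisson_process_hits[OF M \<Psi> fin disj c a]
    by (simp add: power_mult_distrib)
qed

text \<open>The event that \<open>X i\<close> is true forms, as a one-element family, an
  intersection-stable generator of the sigma-algebra of \<open>X i\<close>. Hence product formulas
  for finitely many true values suffice.\<close>

lemma (in prob_space) indep_vars_boolI: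
  fixes X :: "'i \<Rightarrow> 'a \<Rightarrow> bool"
  assumes X: "\<And>i. i \<in> I \<Longrightarrow> Measurable.pred M (X i)"
    and ind: "\<And>J. J \<subseteq> I \<Longrightarrow> finite J \<Longrightarrow> prob {\<omega> \<in> space M. \<forall>i\<in>J. X i \<omega>} = (\<Prod>i\<in>J. prob {\<omega> \<in> space M. X i \<omega>})"
  shows "indep_vars (\<lambda>_. count_space UNIV) X I"
proof -
  let ?E = "\<lambda>i. {\<omega> \<in> space M. X i \<omega>}"
  have E: "?E i \<in> events" if "i \<in> I" for i using X[OF that] by (simp add: pred_def)
  have "indep_events ?E I"
    unfolding indep_events_def
  proof (intro conjI allI impI)
    fix J assume J: "J \<subseteq> I" "J \<noteq> {}" "finite J"
    have "(\<Inter>i\<in>J. ?E i) = {\<omega> \<in> space M. \<forall>i\<in>J. X i \<omega>}" using J by blast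
    then show "prob (\<Inter>i\<in>J. ?E i) = (\<Prod>i\<in>J. prob (?E i))" using ind J by simp
  qed (use E in blast)
  then have "indep_sets (\<lambda>i. {?E i}) I" by (simp add: indep_events_def_alt)
  then have "indep_sets (\<lambda>i. sigma_sets (space M) {?E i}) I"
    by (rule indep_sets_sigma) (simp add: Int_stable_def)
  then show ?thesis
    unfolding indep_vars_def2
  proof (intro conjI ballI, goal_cases)
    case (1 i)
    then show ?case using X by simp
  next
    case 2
    then show ?case
    proof (rule indep_sets_mono_sets, safe)
      fix i A assume "i \<in> I"
      have "X i -` A \<inter> space M = (if True \<in> A then ?E i else {}) \<union> (if False \<in> A then space M - ?E i else {})"
      proof (rule set_eqI)
        fix \<omega>
        show "\<omega> \<in> X i -` A \<inter> space M \<longleftrightarrow>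
          \<omega> \<in> (if True \<in> A then ?E i else {}) \<union> (if False \<in> A then space M - ?E i else {})"
          by (cases "X i \<omega>") auto
      qed
      also have "\<dots> \<in> sigma_sets (space M) {?E i}"
        by (intro sigma_sets_Un) (simp_all add: sigma_sets.intros)
      finally show "X i -` A \<inter> space M \<in> sigma_sets (space M) {?E i}" .
    qed
  qed
qed

lemma distr_bool_eq_bernoulli:
  assumes M: "prob_space M" and X: "Measurable.pred M X" and q: "measure M {\<omega> \<in> space M. X \<omega>} = q"
  shows "distr M (count_space UNIV) X = measure_pmf (bernoulli_pmf q)"
proof -
  interpret prob_space M by fact
  have q01: "0 \<le> q" "q \<le> 1" using q by auto
  show ?thesis
  proof (rule measure_eqI_countable[of _ UNIV])
    fix b :: bool
    have T: "emeasure M {\<omega> \<in> space M. X \<omega>} = ennreal q" using q by (simp add: emeasure_eq_measure)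
    have F: "emeasure M {\<omega> \<in> space M. \<not> X \<omega>} = ennreal (1 - q)"
      using q prob_neg[of X] X by (simp add: emeasure_eq_measure)
    have "X -` {True} \<inter> space M = {\<omega> \<in> space M. X \<omega>}" "X -` {False} \<inter> space M = {\<omega> \<in> space M. \<not> X \<omega>}"
      by auto
    then show "emeasure (distr M (count_space UNIV) X) {b} = emeasure (measure_pmf (bernoulli_pmf q)) {b}"
      using X T F q01 by (cases b) (simp_all add: emeasure_distr emeasure_pmf_single)
  qed auto
qed

text \<open>The product formula for finite \<open>J\<close> gives independence of the whole family
  over \<open>V\<close>, hence equality of laws. The field is restricted to \<open>V\<close> because
  points of the product space are extensional.\<close>

lemma distr_both_hit:
  fixes \<Phi> \<Psi> :: "'w \<Rightarrow> 'a::euclidean_space set"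
  assumes PP: "indep_poisson_processes M lam \<mu> \<Phi> \<Psi>" and V: "V \<noteq> {}"
    and disj: "disjoint_family_on c V"
    and c: "\<And>v. v \<in> V \<Longrightarrow> c v \<in> sets borel" "\<And>v. v \<in> V \<Longrightarrow> bounded (c v)"
      "\<And>v. v \<in> V \<Longrightarrow> measure lborel (c v) = a" and a: "a > 0"
    and q: "q = (1 - exp (- lam * a)) * (1 - exp (- \<mu> * a))"
  shows "distr M (\<Pi>\<^sub>M v\<in>V. count_space UNIV) (\<lambda>\<omega>. \<lambda>v\<in>V. both_hit \<Phi> \<Psi> (c v) \<omega>)
    = (\<Pi>\<^sub>M v\<in>V. measure_pmf (bernoulli_pmf q))"
    and "\<And>v. v \<in> V \<Longrightarrow> Measurable.pred M (both_hit \<Phi> \<Psi> (c v))"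
proof -
  have M: "prob_space M" and \<Phi>: "poisson_process M lam \<Phi>" and \<Psi>: "poisson_process M \<mu> \<Psi>"
    using PP by (auto simp: indep_poisson_processes_def)
  interpret prob_space M by fact
  let ?X = "\<lambda>v. both_hit \<Phi> \<Psi> (c v)"
  have hitm: "Measurable.pred M (\<lambda>\<omega>. \<Xi> \<omega> \<inter> c v \<noteq> {})" if "v \<in> V" and "\<Xi> \<in> measurable M config_space" for v \<Xi>
  proof -
    have "Measurable.pred config_space (\<lambda>\<phi>. \<phi> \<inter> c v \<noteq> {})"
      using hits_sets[OF c(1,2)[OF that(1)]] unfolding pred_def .
    from measurable_compose[OF that(2) this] show ?thesis .
  qed
  show X: "Measurable.pred M (?X v)" if "v \<in> V" for v
    unfolding both_hit_def
    using hitm[OF that poisson_process_measurable[OF \<Phi>]] hitm[OF that poisson_process_measurable[OF \<Psi>]]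
    by (rule pred_intros_logic)
  have prob: "prob {\<omega> \<in> space M. \<forall>v\<in>J. ?X v \<omega>} = q ^ card J" if "J \<subseteq> V" "finite J" for J
    unfolding q using that disj c
    by (intro both_hit_prob[OF PP]) (auto intro: a disjoint_family_on_mono)
  have prob1: "prob {\<omega> \<in> space M. ?X v \<omega>} = q" if "v \<in> V" for v
    using prob[of "{v}"] that by simp
  have "indep_vars (\<lambda>_. count_space UNIV) ?X V"
    by (rule indep_vars_boolI[OF X]) (use prob prob1 in \<open>auto simp: subset_iff\<close>)
  then have "distr M (\<Pi>\<^sub>M v\<in>V. count_space UNIV) (\<lambda>\<omega>. \<lambda>v\<in>V. ?X v \<omega>)
      = (\<Pi>\<^sub>M v\<in>V. distr M (count_space UNIV) (?X v))"
    using X by (subst (asm) indep_vars_iff_distr_eq_PiM'[OF V]) auto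
  also have "\<dots> = (\<Pi>\<^sub>M v\<in>V. measure_pmf (bernoulli_pmf q))"
    using distr_bool_eq_bernoulli[OF M X prob1] by (intro PiM_cong) auto
  finally show "distr M (\<Pi>\<^sub>M v\<in>V. count_space UNIV) (\<lambda>\<omega>. \<lambda>v\<in>V. ?X v \<omega>)
    = (\<Pi>\<^sub>M v\<in>V. measure_pmf (bernoulli_pmf q))" .
qed

section \<open>Renormalisation on the quadrant\<close>

definition grid_adj :: "nat \<times> nat \<Rightarrow> nat \<times> nat \<Rightarrow> bool" where
  "grid_adj a b \<longleftrightarrow> (fst a = fst b \<and> (snd a = Suc (snd b) \<or> snd b = Suc (snd a))) \<or>
                (snd a = snd b \<and> (fst a = Suc (fst b) \<or> fst b = Suc (fst a)))"

definition children :: "nat \<times> nat \<Rightarrow> (nat \<times> nat) set" where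
  "children b = {s. fst s div 3 = fst b \<and> snd s div 3 = snd b}"

definition child :: "nat \<times> nat \<Rightarrow> nat \<Rightarrow> nat \<Rightarrow> nat \<times> nat" where
  "child b i j = (3 * fst b + i, 3 * snd b + j)"

text \<open>A square of side \<open>3 ^ n\<close>, indexed by its position among the squares of that
  level. With \<open>div\<close>, nesting and disjointness become facts about integer
  division.\<close>

definition block :: "nat \<Rightarrow> nat \<times> nat \<Rightarrow> (nat \<times> nat) set" where
  "block n b = {s. fst s div 3 ^ n = fst b \<and> snd s div 3 ^ n = snd b}"

lemma children_eq: "children b = {child b i j |i j. i \<in> {0,1,2} \<and> j \<in> {0,1,2}}"
proof -
  have "x div 3 = c \<longleftrightarrow> (\<exists>i\<in>{0,1,2}. x = 3 * c + i)" for x c :: nat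
    by simp presburger
  then show ?thesis unfolding children_def child_def by (auto simp: prod_eq_iff) 
qed

lemma children_block: "s \<in> children b \<Longrightarrow> block n s \<subseteq> block (Suc n) b"
  by (auto simp: children_def block_def div_mult2_eq power_Suc2 simp del: power_Suc)

lemma block_disjoint: "s \<noteq> t \<Longrightarrow> block n s \<inter> block n t = {}"
  by (auto simp: block_def prod_eq_iff)

lemma finite_children [simp]: "finite (children b)"
  and card_children: "card (children b) \<le> 9"
proof -
  have eq: "children b = (\<lambda>(i, j). child b i j) ` ({0,1,2} \<times> {0,1,2})"
    unfolding children_eq by (auto simp: image_iff) 
  show "finite (children b)" unfolding eq by blast
  have "card (children b) \<le> card ({0,1,2::nat} \<times> {0,1,2::nat})"
    unfolding eq by (rule card_image_le) blast
  then show "card (children b) \<le> 9" by (simp add: card_cartesian_product)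
qed

text \<open>The bound on bad sub-blocks is phrased through pairs so that its negation hands over two
  distinct bad sub-blocks, which is what the witnesses are built from.\<close>

fun good :: "(nat \<times> nat \<Rightarrow> bool) \<Rightarrow> nat \<Rightarrow> nat \<times> nat \<Rightarrow> bool" where
  "good X 0 b = X b"
| "good X (Suc n) b = (\<forall>s\<in>children b. \<forall>t\<in>children b. s \<noteq> t \<longrightarrow> good X n s \<or> good X n t)"

text \<open>Level 0 does not consult \<open>X\<close>, so it is for good blocks that the cluster is
  known to consist of open sites.\<close>

fun cluster :: "(nat \<times> nat \<Rightarrow> bool) \<Rightarrow> nat \<Rightarrow> nat \<times> nat \<Rightarrow> (nat \<times> nat) set" where
  "cluster X 0 b = {b}"
| "cluster X (Suc n) b = (\<Union>s\<in>{s \<in> children b. good X n s}. cluster X n s)"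

text \<open>The possible sets of closed sites that make a level-\<open>n\<close> block bad.\<close>

fun witnesses :: "nat \<Rightarrow> nat \<times> nat \<Rightarrow> (nat \<times> nat) set set" where
  "witnesses 0 b = {{b}}"
| "witnesses (Suc n) b =
     (\<Union>(s, t)\<in>{(s, t). s \<in> children b \<and> t \<in> children b \<and> s \<noteq> t}.
        (\<lambda>(A, B). A \<union> B) ` (witnesses n s \<times> witnesses n t))"

lemma witnesses_bad: "\<not> good X n b \<Longrightarrow> \<exists>A\<in>witnesses n b. \<forall>q\<in>A. \<not> X q"
proof (induction n arbitrary: b)
  case (Suc n)
  then obtain s t where st: "s \<in> children b" "t \<in> children b" "s \<noteq> t"
    and bad: "\<not> good X n s" "\<not> good X n t" by auto
  obtain A B where AB: "A \<in> witnesses n s" "\<forall>q\<in>A. \<not> X q" "B \<in> witnesses n t" "\<forall>q\<in>B. \<not> X q"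
    using Suc.IH bad by meson
  have "A \<union> B \<in> witnesses (Suc n) b"
    unfolding witnesses.simps using st AB
    by (intro UN_I[of "(s, t)"]) (auto simp: image_iff intro!: bexI[of _ "(A, B)"])
  with AB show ?case by blast
qed auto

text \<open>Distinct sub-blocks are disjoint, so uniting two witnesses doubles the number of closed
  sites. This doubling produces the square in the recursion for the bad-block probability.\<close>

lemma witnesses_card:
  "A \<in> witnesses n b \<Longrightarrow> finite A \<and> A \<subseteq> block n b \<and> card A = 2 ^ n"
proof (induction n arbitrary: A b)
  case 0
  then show ?case by (auto simp: block_def)
next
  case (Suc n)
  then obtain s t B C where st: "s \<in> children b" "t \<in> children b" "s \<noteq> t"
    and BC: "B \<in> witnesses n s" "C \<in> witnesses n t" and A: "A = B \<union> C" by auto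
  have B: "finite B \<and> B \<subseteq> block n s \<and> card B = 2 ^ n"
    and C: "finite C \<and> C \<subseteq> block n t \<and> card C = 2 ^ n"
    using Suc.IH BC by blast+
  have "B \<inter> C = {}" using B C block_disjoint[OF st(3), of n] by blast
  then have "card A = 2 ^ Suc n" using A B C by (simp add: card_Un_disjoint)
  with A B C show ?case
    using children_block[OF st(1), of n] children_block[OF st(2), of n] by blast
qed

text \<open>If \<open>w\<close> bounds the number of witnesses at one level,
  \<open>81 * w ^ 2\<close> bounds it at the next. Multiplying by 81 turns this into pure squaring,
  which explains the shape of the bound.\<close>

lemma witnesses_count: "finite (witnesses n b) \<and> 81 * card (witnesses n b) \<le> 81 ^ 2 ^ n"
proof (induction n arbitrary: b)
  case (Suc n)
  let ?P = "{(s, t). s \<in> children b \<and> t \<in> children b \<and> s \<noteq> t}"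
  let ?F = "\<lambda>(s, t). (\<lambda>(A, B). A \<union> B) ` (witnesses n s \<times> witnesses n t)"
  have sub: "?P \<subseteq> children b \<times> children b" by auto
  have finP: "finite ?P" by (rule finite_subset[OF sub]) simp
  have "card ?P \<le> card (children b \<times> children b)" by (rule card_mono[OF _ sub]) simp
  also have "\<dots> \<le> 9 * 9"
    unfolding card_cartesian_product using card_children by (intro mult_mono) auto
  finally have cP: "card ?P \<le> 81" by simp
  have F: "finite (?F x) \<and> 81 * (81 * card (?F x)) \<le> 81 ^ 2 ^ Suc n" for x
  proof -
    obtain s t where x: "x = (s, t)" by (cases x)
    have "card (?F x) \<le> card (witnesses n s \<times> witnesses n t)"
      unfolding x split using Suc.IH by (intro card_image_le) simp
    then have "81 * (81 * card (?F x)) \<le> (81 * card (witnesses n s)) * (81 * card (witnesses n t))"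
      by (simp add: card_cartesian_product)
    also have "\<dots> \<le> 81 ^ 2 ^ n * 81 ^ 2 ^ n"
      using Suc.IH by (intro mult_mono) auto
    also have "\<dots> = 81 ^ 2 ^ Suc n" by (simp add: power_add[symmetric] mult_2)
    finally show ?thesis using Suc.IH unfolding x by auto
  qed
  have "81 * (81 * card (\<Union>(?F ` ?P))) \<le> 81 * (81 * (\<Sum>x\<in>?P. card (?F x)))"
    using card_UN_le[OF finP, of ?F] by (intro mult_le_mono2)
  also have "\<dots> = (\<Sum>x\<in>?P. 81 * (81 * card (?F x)))" by (simp add: sum_distrib_left)
  also have "\<dots> \<le> card ?P * 81 ^ 2 ^ Suc n" using F by (intro sum_bounded_above[THEN order_trans]) auto
  also have "\<dots> \<le> 81 * 81 ^ 2 ^ Suc n" using cP by (rule mult_le_mono1)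
  finally have "81 * card (\<Union>(?F ` ?P)) \<le> 81 ^ 2 ^ Suc n" by simp
  moreover have "finite (\<Union>(?F ` ?P))" using finP F by blast
  ultimately show ?case by simp
qed auto

text \<open>A hole spoils one row and one column. Every good position lies in an intact row or an
  intact column, and each of these meets an intact line of the other direction. An arbitrary
  spreading predicate \<open>A\<close> is allowed so that it can stand for reaching whole
  sub-clusters.\<close>

lemma grid_minus_one_connected:
  fixes A g :: "nat \<Rightarrow> nat \<Rightarrow> bool"
  assumes one: "\<And>i j k l. i < 3 \<Longrightarrow> j < 3 \<Longrightarrow> k < 3 \<Longrightarrow> l < 3 \<Longrightarrow> i \<noteq> k \<or> j \<noteq> l \<Longrightarrow> g i j \<or> g k l"
    and step: "\<And>i j k l. i < 3 \<Longrightarrow> j < 3 \<Longrightarrow> k < 3 \<Longrightarrow> l < 3 \<Longrightarrow> g i j \<Longrightarrow> g k l \<Longrightarrow>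
       grid_adj (i, j) (k, l) \<Longrightarrow> A i j \<Longrightarrow> A k l"
    and start: "i < 3" "j < 3" "g i j" "A i j" and fin: "k < 3" "l < 3" "g k l"
  shows "A k l"
proof -
  \<comment> \<open>As a 0/1 value, spreading in both directions becomes an equality, which chains
    along lines.\<close>
  define B :: "nat \<Rightarrow> nat \<Rightarrow> nat" where "B i j = of_bool (A i j)" for i j
  have r: "B i j = B i (Suc j)" if "i < 3" "j < 2" "g i j" "g i (Suc j)" for i j
  proof -
    have "Suc j < 3" "j < 3" "grid_adj (i, j) (i, Suc j)" "grid_adj (i, Suc j) (i, j)"
      using that by (auto simp: grid_adj_def)
    then have "A i j \<longleftrightarrow> A i (Suc j)" using step that by blast
    then show ?thesis by (simp add: B_def)
  qed
  have c: "B i j = B (Suc i) j" if "i < 2" "j < 3" "g i j" "g (Suc i) j" for i j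
  proof -
    have "Suc i < 3" "i < 3" "grid_adj (i, j) (Suc i, j)" "grid_adj (Suc i, j) (i, j)"
      using that by (auto simp: grid_adj_def)
    then have "A i j \<longleftrightarrow> A (Suc i) j" using step that by blast
    then show ?thesis by (simp add: B_def)
  qed
  have lt3: "x = 0 \<or> x = 1 \<or> x = 2" if "x < 3" for x :: nat using that by auto
  have const: "f x = f y" if "f 0 = f 1" "f 1 = f 2" "x < 3" "y < 3" for f :: "nat \<Rightarrow> nat" and x y
    using that(1,2) lt3[OF that(3)] lt3[OF that(4)] by (elim disjE) simp_all
  have row: "B i j = B i l" if "i < 3" "\<forall>j<3. g i j" "j < 3" "l < 3" for i j l
    using r[of i 0] r[of i 1] that by (intro const[of "B i" j l]) (simp_all add: numeral_2_eq_2)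
  have col: "B i j = B k j" if "j < 3" "\<forall>i<3. g i j" "i < 3" "k < 3" for i j k
    using c[of 0 j] c[of 1 j] that by (intro const[of "\<lambda>i. B i j" i k]) (simp_all add: numeral_2_eq_2)
  have "\<exists>m n. (\<forall>i<3. \<forall>j<3. i \<noteq> m \<or> j \<noteq> n \<longrightarrow> g i j) \<and> (g m n \<longrightarrow> m \<ge> 3 \<or> n \<ge> 3)"
  proof (cases "\<forall>i<3. \<forall>j<3. g i j")
    case True
    \<comment> \<open>Without a hole, the index 3 points outside the grid.\<close>
    then show ?thesis by (intro exI[of _ 3]) simp
  next
    case False
    then obtain m n where mn: "m < 3" "n < 3" "\<not> g m n" by blast
    have "g i j" if "i < 3" "j < 3" "i \<noteq> m \<or> j \<noteq> n" for i j
      using one[OF that(1,2) mn(1,2) that(3)] mn(3) by simp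
    then show ?thesis using mn(3) by blast
  qed
  then obtain m n where mn: "\<forall>i<3. \<forall>j<3. i \<noteq> m \<or> j \<noteq> n \<longrightarrow> g i j"
    and gmn: "g m n \<longrightarrow> m \<ge> 3 \<or> n \<ge> 3" by (elim exE conjE) (rule that)
  \<comment> \<open>Row \<open>i'\<close> and column \<open>j'\<close> avoid the hole; both given
    positions can be joined to their crossing.\<close>
  have "\<exists>i'<3. i' \<noteq> m" for m :: nat by (rule exI[of _ "if m = 0 then 1 else 0"]) simp
  then obtain i' j' :: nat where other: "i' < 3" "i' \<noteq> m" "j' < 3" "j' \<noteq> n" by metis
  have pq: "i \<noteq> m \<or> j \<noteq> n" "k \<noteq> m \<or> l \<noteq> n" using start fin gmn by auto
  have row': "B i j = B i l" if "i < 3" "i \<noteq> m" "j < 3" "l < 3" for i j l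
    using row mn that by blast
  have col': "B i j = B k j" if "j < 3" "j \<noteq> n" "i < 3" "k < 3" for i j k
    using col mn that by blast
  have "B i j = B k l"
    using pq row' col' other start(1,2) fin(1,2) by (metis (no_types))
  then show ?thesis using start by (cases "A k l") (simp_all add: B_def)
qed

lemma cluster_nonempty: "good X n b \<Longrightarrow> cluster X n b \<noteq> {}"
proof (induction n arbitrary: b)
  case (Suc n)
  have "child b 0 0 \<in> children b" "child b 0 1 \<in> children b" "child b 0 0 \<noteq> child b 0 1"
    by (auto simp: children_def child_def)
  then have "\<exists>s\<in>children b. good X n s" using Suc.prems by auto
  then show ?case using Suc.IH by auto
qed auto

lemma cluster_block: "cluster X n b \<subseteq> block n b"
proof (induction n arbitrary: b)
  case (Suc n)
  then show ?case unfolding cluster.simps using children_block by blast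
qed (auto simp: block_def)

text \<open>One block and two adjacent blocks are treated in a single induction, since joining the
  sub-blocks inside a block already uses adjacent blocks one level down.\<close>

lemma cluster_connected:
  assumes "good X n a" "good X n b" "a = b \<or> grid_adj a b" "u \<in> cluster X n a" "v \<in> cluster X n b"
  shows "(u, v) \<in> {(u, v). u \<in> {p. X p} \<and> v \<in> {p. X p} \<and> grid_adj u v}\<^sup>*"
    (is "_ \<in> ?R\<^sup>*")
  using assms
proof (induction n arbitrary: a b u v)
  case 0
  then show ?case by auto
next
  case (Suc n)
  have within: "(u, v) \<in> ?R\<^sup>*"
    if b: "good X (Suc n) b" and s: "s \<in> children b" "good X n s" "u \<in> cluster X n s"
      and t: "t \<in> children b" "good X n t" "v \<in> cluster X n t" for b s t u v
  proof -
    obtain i j where ij: "s = child b i j" "i < 3" "j < 3" using s(1) unfolding children_eq by force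
    obtain k l where kl: "t = child b k l" "k < 3" "l < 3" using t(1) unfolding children_eq by force
    have ch: "child b i j \<in> children b" if "i < 3" "j < 3" for i j
      using that by (auto simp: children_def child_def)
    \<comment> \<open>The spreading predicate: \<open>u\<close> reaches the whole cluster of a
      sub-block. It passes to an adjacent good sub-block through any site of the nonempty
      cluster.\<close>
    have "\<forall>v\<in>cluster X n (child b k l). (u, v) \<in> ?R\<^sup>*"
    proof (rule grid_minus_one_connected[where g = "\<lambda>i j. good X n (child b i j)" and i = i and j = j])
      fix i j k l :: nat
      assume lt: "i < 3" "j < 3" "k < 3" "l < 3"
      {
        assume "i \<noteq> k \<or> j \<noteq> l"
        then have "child b i j \<noteq> child b k l" by (auto simp: child_def)
        then show "good X n (child b i j) \<or> good X n (child b k l)"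
          using b ch lt by auto
      }
      assume g: "good X n (child b i j)" "good X n (child b k l)" and adj: "grid_adj (i, j) (k, l)"
        and A: "\<forall>v\<in>cluster X n (child b i j). (u, v) \<in> ?R\<^sup>*"
      have "grid_adj (child b i j) (child b k l)"
        using adj by (auto simp: grid_adj_def child_def)
      moreover obtain w where "w \<in> cluster X n (child b i j)" using cluster_nonempty[OF g(1)] by blast
      ultimately show "\<forall>v\<in>cluster X n (child b k l). (u, v) \<in> ?R\<^sup>*"
        using A Suc.IH[OF g] by (meson rtrancl_trans)
    qed (use Suc.IH[OF s(2) s(2)] s t ij kl in auto)
    then show ?thesis using t(3) kl by simp
  qed
  obtain s where s: "s \<in> children a" "good X n s" "u \<in> cluster X n s" using Suc.prems by auto
  obtain t where t: "t \<in> children b" "good X n t" "v \<in> cluster X n t" using Suc.prems by auto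
  show ?case
  proof (cases "a = b")
    case True
    then show ?thesis using within[of b s u t v] s t Suc.prems by blast
  next
    case False
    then have adj: "grid_adj a b" using Suc.prems by blast
    \<comment> \<open>Three pairs of adjacent sub-blocks face each other across the common
      side.\<close>
    have "\<exists>f h. (\<forall>i\<in>{0,1,2::nat}. f i \<in> children a \<and> h i \<in> children b \<and> grid_adj (f i) (h i)) \<and>
      inj_on f {0,1,2} \<and> inj_on h {0,1,2}"
    proof -
      obtain a1 a2 b1 b2 where ab: "a = (a1, a2)" "b = (b1, b2)" by force
      consider "a1 = b1" "a2 = Suc b2" | "a1 = b1" "b2 = Suc a2"
        | "a2 = b2" "a1 = Suc b1" | "a2 = b2" "b1 = Suc a1"
        using adj ab by (auto simp: grid_adj_def)
      then show ?thesis
      proof cases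
        case 1
        show ?thesis
          by (rule exI[of _ "\<lambda>i. child a i 0"], rule exI[of _ "\<lambda>i. child b i 2"])
            (auto simp: 1 ab children_def child_def grid_adj_def inj_on_def)
      next
        case 2
        show ?thesis
          by (rule exI[of _ "\<lambda>i. child a i 2"], rule exI[of _ "\<lambda>i. child b i 0"])
            (auto simp: 2 ab children_def child_def grid_adj_def inj_on_def)
      next
        case 3
        show ?thesis
          by (rule exI[of _ "\<lambda>i. child a 0 i"], rule exI[of _ "\<lambda>i. child b 2 i"])
            (auto simp: 3 ab children_def child_def grid_adj_def inj_on_def)
      next
        case 4
        show ?thesis
          by (rule exI[of _ "\<lambda>i. child a 2 i"], rule exI[of _ "\<lambda>i. child b 0 i"])
            (auto simp: 4 ab children_def child_def grid_adj_def inj_on_def)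
      qed
    qed
    then obtain f h where fh': "\<forall>i\<in>{0,1,2::nat}. f i \<in> children a \<and> h i \<in> children b \<and> grid_adj (f i) (h i)"
      and inj: "inj_on f {0,1,2}" "inj_on h {0,1,2}" by (elim exE conjE) (rule that)
    note fh = bspec[OF fh']
    have two: "good X n (f i) \<or> good X n (f j)" "good X n (h i) \<or> good X n (h j)"
      if ij: "i \<in> {0,1,2}" "j \<in> {0,1,2}" "i \<noteq> j" for i j
    proof -
      have ne: "f i \<noteq> f j" "h i \<noteq> h j" using inj ij by (meson inj_onD)+
      have "\<forall>s\<in>children a. \<forall>t\<in>children a. s \<noteq> t \<longrightarrow> good X n s \<or> good X n t"
        "\<forall>s\<in>children b. \<forall>t\<in>children b. s \<noteq> t \<longrightarrow> good X n s \<or> good X n t"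
        using Suc.prems(1,2) by simp_all
      then show "good X n (f i) \<or> good X n (f j)" "good X n (h i) \<or> good X n (h j)"
        using ne fh[OF ij(1)] fh[OF ij(2)] by blast+
    qed
    \<comment> \<open>Each of the two blocks spoils at most one of the three pairs, so one pair is
      good on both sides.\<close>
    have "\<exists>i\<in>{0,1,2}. good X n (f i) \<and> good X n (h i)"
    proof -
      have "good X n (f 0) \<or> good X n (f 1)" "good X n (f 0) \<or> good X n (f 2)" "good X n (f 1) \<or> good X n (f 2)"
        "good X n (h 0) \<or> good X n (h 1)" "good X n (h 0) \<or> good X n (h 2)" "good X n (h 1) \<or> good X n (h 2)"
        by (rule two; simp)+
      then show ?thesis by blast
    qed
    then obtain i where i: "i \<in> {0,1,2}" "good X n (f i)" "good X n (h i)" by blast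
    obtain y z where yz: "y \<in> cluster X n (f i)" "z \<in> cluster X n (h i)"
      using cluster_nonempty i by blast
    have "(u, y) \<in> ?R\<^sup>*" using within[of a s u "f i" y] s i yz fh[of i] Suc.prems by blast
    moreover have "(y, z) \<in> ?R\<^sup>*" using Suc.IH[OF i(2,3) _ yz] fh[OF i(1)] by blast
    moreover have "(z, v) \<in> ?R\<^sup>*" using within[of b "h i" z t v] t i yz fh[of i] Suc.prems by blast
    ultimately show ?thesis by (meson rtrancl_trans)
  qed
qed

lemma good_percolates:
  assumes "\<And>n. good X n (0, 0)"
  shows "percolates {p. X p} grid_adj"
proof -
  let ?R = "{(u, v). u \<in> {p. X p} \<and> v \<in> {p. X p} \<and> grid_adj u v}"
  let ?C = "\<lambda>n. cluster X n (0, 0)"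
  have zero: "(0, 0) \<in> children (0, 0)" by (simp add: children_def)
  have mono: "?C n \<subseteq> ?C (Suc n)" for n using assms zero by auto
  have sub: "(\<Union>n. ?C n) \<subseteq> ?R\<^sup>* `` {(0, 0)}"
  proof
    fix v assume "v \<in> (\<Union>n. ?C n)"
    then obtain n where "v \<in> ?C n" by blast
    moreover have "(0, 0) \<in> ?C n"
      using lift_Suc_mono_le[of ?C, OF mono, of 0 n] by auto
    ultimately show "v \<in> ?R\<^sup>* `` {(0, 0)}" using cluster_connected[OF assms assms] by blast
  qed
  \<comment> \<open>One of the sub-blocks \<open>(0, 1)\<close> and \<open>(1, 0)\<close> is good,
    so the next cluster leaves the old block.\<close>
  have new: "\<not> ?C (Suc n) \<subseteq> block n (0, 0)" for n
  proof -
    let ?a = "(0, 1) :: nat \<times> nat" and ?b = "(1, 0) :: nat \<times> nat"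
    have "?a \<in> children (0, 0)" "?b \<in> children (0, 0)" by (auto simp: children_def)
    moreover have "good X n ?a \<or> good X n ?b"
      using assms[of "Suc n"] by (auto simp: children_def)
    ultimately obtain s where s: "s \<in> children (0, 0)" "good X n s" "s \<noteq> (0, 0)" by auto
    obtain w where w: "w \<in> cluster X n s" using cluster_nonempty[OF s(2)] by blast
    then have "w \<in> ?C (Suc n)" unfolding cluster.simps using s by blast
    moreover have "w \<notin> block n (0, 0)"
      using w cluster_block[of X n s] block_disjoint[OF s(3), of n] by blast
    ultimately show ?thesis by blast
  qed
  have "infinite (\<Union>n. ?C n)"
  proof
    assume "finite (\<Union>n. ?C n)"
    then obtain N where "\<forall>p\<in>(\<Union>n. ?C n). max (fst p) (snd p) < N"
      using finite_nat_set_iff_bounded[of "(\<lambda>p. max (fst p) (snd p)) ` (\<Union>n. ?C n)"] by auto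
    \<comment> \<open>Hence the level-\<open>N\<close> block at the origin contains all sites with
      coordinates below \<open>N\<close>.\<close>
    moreover have "N < 3 ^ N" by (rule less_exp[THEN less_le_trans]) (simp add: power_mono)
    ultimately have "(\<Union>n. ?C n) \<subseteq> block N (0, 0)"
      unfolding block_def by fastforce
    then show False using new[of N] by blast
  qed
  then have "infinite (?R\<^sup>* `` {(0, 0)})" using sub infinite_super by blast
  moreover have "X (0, 0)" using assms[of 0] by simp
  ultimately show ?thesis unfolding percolates_iff by blast
qed

section \<open>Bernoulli site percolation\<close>

lemma pred_reach_sites:
  assumes "countable V" "\<And>v. v \<in> V \<Longrightarrow> Measurable.pred M (\<lambda>\<omega>. X \<omega> v)"
  shows "Measurable.pred M (\<lambda>\<omega>. reach {v \<in> V. X \<omega> v} E n x y)"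
proof (induction n arbitrary: y)
  case (Suc n)
  have "Measurable.pred M (\<lambda>\<omega>. \<exists>z\<in>V. X \<omega> z \<and> E z y \<and> reach {v \<in> V. X \<omega> v} E n x z)"
    using assms Suc.IH by (intro assms(1) measurable_pred_countable pred_intros_logic) auto
  then show ?case by (simp add: conj_ac Bex_def)
qed simp

text \<open>A cluster is infinite iff it escapes every finite subset of \<open>V\<close>, and a
  countable \<open>V\<close> has only countably many of these.\<close>

lemma pred_site_percolates:
  assumes V: "countable V" and X: "\<And>v. v \<in> V \<Longrightarrow> Measurable.pred M (\<lambda>\<omega>. X \<omega> v)"
  shows "Measurable.pred M (\<lambda>\<omega>. percolates {v \<in> V. X \<omega> v} E)"
proof -
  let ?W = "\<lambda>\<omega>. {v \<in> V. X \<omega> v}"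
  have "percolates (?W \<omega>) E \<longleftrightarrow>
    (\<exists>v\<in>V. X \<omega> v \<and> (\<forall>F\<in>{F. finite F \<and> F \<subseteq> V}. \<exists>u\<in>V. u \<notin> F \<and> X \<omega> u \<and> (\<exists>n. reach (?W \<omega>) E n v u)))" for \<omega>
  proof -
    let ?S = "\<lambda>v. {u \<in> ?W \<omega>. \<exists>n. reach (?W \<omega>) E n v u}"
    have 1: "infinite S \<longleftrightarrow> (\<forall>F\<in>{F. finite F \<and> F \<subseteq> V}. \<exists>u\<in>S. u \<notin> F)" if "S \<subseteq> V" for S
    proof
      assume inf: "infinite S"
      show "\<forall>F\<in>{F. finite F \<and> F \<subseteq> V}. \<exists>u\<in>S. u \<notin> F"
        using inf finite_subset[of S] by blast
    qed (use that in blast)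
    have 2: "{(u, v). u \<in> ?W \<omega> \<and> v \<in> ?W \<omega> \<and> E u v}\<^sup>* `` {v} = ?S v" if "v \<in> ?W \<omega>" for v
      using reach_iff_rtrancl[OF that] by auto
    have "percolates (?W \<omega>) E \<longleftrightarrow> (\<exists>v\<in>?W \<omega>. infinite (?S v))"
      unfolding percolates_iff by (rule bex_cong[OF refl]) (simp only: 2)
    also have "\<dots> \<longleftrightarrow> (\<exists>v\<in>?W \<omega>. \<forall>F\<in>{F. finite F \<and> F \<subseteq> V}. \<exists>u\<in>?S v. u \<notin> F)"
      by (rule bex_cong[OF refl], rule 1) blast
    also have "\<dots> \<longleftrightarrow> (\<exists>v\<in>V. X \<omega> v \<and>
        (\<forall>F\<in>{F. finite F \<and> F \<subseteq> V}. \<exists>u\<in>V. u \<notin> F \<and> X \<omega> u \<and> (\<exists>n. reach (?W \<omega>) E n v u)))"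
      unfolding Bex_def Ball_def mem_Collect_eq by (intro iff_exI) (simp only: conj_ac)
    finally show ?thesis .
  qed
  moreover have "Measurable.pred M (\<lambda>\<omega>. \<exists>v\<in>V. X \<omega> v \<and>
      (\<forall>F\<in>{F. finite F \<and> F \<subseteq> V}. \<exists>u\<in>V. u \<notin> F \<and> X \<omega> u \<and> (\<exists>n. reach (?W \<omega>) E n v u)))"
    by (intro measurable_pred_countable pred_intros_logic V pred_intros_countable
        countable_Collect_finite_subset X pred_reach_sites) (assumption | (rule measurable_const, simp))+
  ultimately show ?thesis by simp
qed

definition site_measure :: "'v set \<Rightarrow> real \<Rightarrow> ('v \<Rightarrow> bool) measure" where
  "site_measure V p = (\<Pi>\<^sub>M v\<in>V. measure_pmf (bernoulli_pmf p))"

lemma site_perc_prob_eq: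
  "site_perc_prob V E p = measure (site_measure V p) {\<omega> \<in> space (site_measure V p). percolates {v \<in> V. \<omega> v} E}"
  by (simp add: site_perc_prob_def site_measure_def Let_def)

lemma prob_space_site_measure: "prob_space (site_measure V p)"
  unfolding site_measure_def by (intro prob_space_PiM measure_pmf.prob_space_axioms)

lemma pred_site_component [measurable]: "v \<in> V \<Longrightarrow> Measurable.pred (site_measure V p) (\<lambda>\<omega>. \<omega> v)"
  unfolding site_measure_def
  using measurable_component_singleton[of v V "\<lambda>_. measure_pmf (bernoulli_pmf p)"]
  by (simp add: measurable_def)

lemma pred_percolates_site_measure:
  "countable V \<Longrightarrow> Measurable.pred (site_measure V p) (\<lambda>\<omega>. percolates {v \<in> V. \<omega> v} E)"
  by (rule pred_site_percolates, assumption, rule pred_site_component)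

lemma site_measure_closed:
  assumes p: "p \<in> {0..1}" and F: "finite F" "F \<subseteq> V"
  shows "measure (site_measure V p) {\<omega> \<in> space (site_measure V p). \<forall>v\<in>F. \<not> \<omega> v} = (1 - p) ^ card F"
proof -
  have "emeasure (site_measure V p) (prod_emb V (\<lambda>_. measure_pmf (bernoulli_pmf p)) F (Pi\<^sub>E F (\<lambda>_. {False})))
    = (\<Prod>v\<in>F. emeasure (measure_pmf (bernoulli_pmf p)) {False})"
    unfolding site_measure_def
    by (rule emeasure_PiM_emb) (use F in \<open>auto intro: measure_pmf.prob_space_axioms\<close>)
  also have "\<dots> = ennreal (1 - p) ^ card F"
    using p by (simp add: emeasure_pmf_single)
  also have "prod_emb V (\<lambda>_. measure_pmf (bernoulli_pmf p)) F (Pi\<^sub>E F (\<lambda>_. {False}))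
    = {\<omega> \<in> space (site_measure V p). \<forall>v\<in>F. \<not> \<omega> v}"
    unfolding prod_emb_def vimage_def restrict_PiE_iff by (auto simp: site_measure_def space_PiM)
  finally show ?thesis
    using p by (simp add: measure_def ennreal_power)
qed

text \<open>Makes the set in the definition of the critical probability nonempty, as an upper bound
  on its real supremum requires.\<close>

lemma site_perc_prob_0:
  assumes V: "countable V"
  shows "site_perc_prob V E 0 = 0"
proof -
  interpret prob_space "site_measure V 0" by (rule prob_space_site_measure)
  have "AE \<omega> in site_measure V 0. \<not> \<omega> v" if v: "v \<in> V" for v
  proof -
    have "prob {\<omega> \<in> space (site_measure V 0). \<not> \<omega> v} = 1"
      using site_measure_closed[of 0 "{v}" V] v by simp
    then show ?thesis using v by (subst (asm) prob_Collect_eq_1) measurable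
  qed
  then have "AE \<omega> in site_measure V 0. \<forall>v\<in>V. \<not> \<omega> v" using V by (simp add: AE_ball_countable)
  then have "AE \<omega> in site_measure V 0. \<not> percolates {v \<in> V. \<omega> v} E"
  proof eventually_elim
    case (elim \<omega>)
    then have eq: "{v \<in> V. \<omega> v} = {}" by blast
    show ?case unfolding eq percolates_iff by blast
  qed
  moreover have "{\<omega> \<in> space (site_measure V 0). percolates {v \<in> V. \<omega> v} E} \<in> events"
    using pred_percolates_site_measure[OF V] unfolding pred_def .
  ultimately show ?thesis
    unfolding site_perc_prob_eq by (subst prob_Collect_eq_0)
qed

text \<open>In the union bound at level \<open>n\<close>, the factor 81 in
  \<open>162 = 2 * 81\<close> absorbs the number of witnesses and leaves 1 / 2 per closed site, that
  is \<open>1 / 81 * (1 / 2) ^ (2 ^ n)\<close>. Summed over \<open>n\<close> this is at most 1 / 81,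
  so with positive probability the blocks of the origin are good at all levels.\<close>

lemma site_perc_prob_pos:
  fixes \<iota> :: "nat \<times> nat \<Rightarrow> 'v"
  assumes V: "countable V" and \<iota>: "inj \<iota>" "range \<iota> \<subseteq> V"
    and adj: "\<And>a b. grid_adj a b \<Longrightarrow> E (\<iota> a) (\<iota> b)"
    and p: "1 - 1 / 162 \<le> p" "p \<le> 1"
  shows "site_perc_prob V E p \<noteq> 0"
proof -
  let ?S = "site_measure V p"
  let ?X = "\<lambda>\<omega> a. \<omega> (\<iota> a)"
  interpret prob_space ?S by (rule prob_space_site_measure)
  have p01: "p \<in> {0..1}" using p by auto
  have [measurable]: "Measurable.pred ?S (\<lambda>\<omega>. \<omega> (\<iota> a))" for a
    using \<iota> by (intro pred_site_component) auto
  have closed: "prob {\<omega> \<in> space ?S. \<forall>a\<in>A. \<not> ?X \<omega> a} \<le> (1 / 162) ^ card A" if "finite A" for A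
  proof -
    have "prob {\<omega> \<in> space ?S. \<forall>v\<in>\<iota> ` A. \<not> \<omega> v} = (1 - p) ^ card (\<iota> ` A)"
      using \<iota> that by (intro site_measure_closed[OF p01]) auto
    also have "\<dots> = (1 - p) ^ card A" using \<iota> by (simp add: card_image inj_on_subset)
    also have "\<dots> \<le> (1 / 162) ^ card A" using p by (intro power_mono) auto
    finally show ?thesis by simp
  qed
  let ?B = "\<lambda>n. \<Union>A\<in>witnesses n (0, 0). {\<omega> \<in> space ?S. \<forall>a\<in>A. \<not> ?X \<omega> a}"
  have Bsets: "{\<omega> \<in> space ?S. \<forall>a\<in>A. \<not> ?X \<omega> a} \<in> events" if "finite A" for A
    using that by measurable
  have fin: "finite A" if "A \<in> witnesses n b" for A n b using witnesses_card[OF that] by blast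
  have Bn: "prob (?B n) \<le> 1 / 81 * (1 / 2) ^ Suc n" for n
  proof -
    have "prob (?B n) \<le> (\<Sum>A\<in>witnesses n (0, 0). prob {\<omega> \<in> space ?S. \<forall>a\<in>A. \<not> ?X \<omega> a})"
      using witnesses_count[of n "(0, 0)"] Bsets fin
      by (intro measure_UNION_le) auto
    also have "\<dots> \<le> (\<Sum>A\<in>witnesses n (0, 0). (1 / 162) ^ 2 ^ n)"
    proof (rule sum_mono)
      fix A assume A: "A \<in> witnesses n (0, 0)"
      show "prob {\<omega> \<in> space ?S. \<forall>a\<in>A. \<not> ?X \<omega> a} \<le> (1 / 162) ^ 2 ^ n"
        using closed[of A] witnesses_card[OF A] by simp
    qed
    also have "\<dots> = 1 / 81 * real (81 * card (witnesses n (0, 0))) * (1 / 162) ^ 2 ^ n" by simp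
    also have "\<dots> \<le> 1 / 81 * real (81 ^ 2 ^ n) * (1 / 162) ^ 2 ^ n"
      using witnesses_count[of n "(0, 0)"] by (intro mult_right_mono mult_left_mono of_nat_mono) auto
    also have "\<dots> = 1 / 81 * (1 / 2) ^ 2 ^ n" by (simp add: power_mult_distrib[symmetric])
    \<comment> \<open>\<open>Suc n \<le> 2 ^ n\<close> allows comparison with the geometric series
      that sums to 1.\<close>
    also have "\<dots> \<le> 1 / 81 * (1 / 2) ^ Suc n"
      by (intro mult_left_mono power_decreasing Suc_leI less_exp) auto
    finally show ?thesis .
  qed
  have half: "(\<lambda>n. 1 / 81 * (1 / 2) ^ Suc n :: real) sums (1 / 81 * 1)"
    by (intro sums_mult power_half_series)
  have sumB: "summable (\<lambda>n. prob (?B n))"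
    by (rule summable_comparison_test[OF _ sums_summable[OF half]]) (use Bn in auto)
  have B: "?B n \<in> events" for n
    using witnesses_count[of n "(0, 0)"] Bsets fin by (intro sets.finite_UN) auto
  have "prob (\<Union>n. ?B n) \<le> (\<Sum>n. prob (?B n))"
    using B sumB by (intro finite_measure_subadditive_countably) auto
  also have "\<dots> \<le> (\<Sum>n. 1 / 81 * (1 / 2) ^ Suc n)"
    using Bn sumB sums_summable[OF half] by (intro suminf_le) auto
  also have "\<dots> = 1 / 81" using sums_unique[OF half] by simp
  finally have small: "prob (\<Union>n. ?B n) \<le> 1 / 81" .
  have U: "(\<Union>n. ?B n) \<in> events" using B by (intro sets.countable_UN) auto
  have "percolates {v \<in> V. \<omega> v} E" if \<omega>: "\<omega> \<in> space ?S - (\<Union>n. ?B n)" for \<omega>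
  proof -
    have "good (?X \<omega>) n (0, 0)" for n
    proof (rule ccontr)
      assume "\<not> good (?X \<omega>) n (0, 0)"
      from witnesses_bad[OF this] obtain A where "A \<in> witnesses n (0, 0)" "\<forall>q\<in>A. \<not> ?X \<omega> q" by blast
      then show False using \<omega> by blast
    qed
    then have "percolates {a. ?X \<omega> a} grid_adj" by (rule good_percolates)
    then show ?thesis
      by (rule percolates_map[where f = \<iota>]) (use \<iota> adj in \<open>auto intro: inj_on_subset\<close>)
  qed
  then have sub: "space ?S - (\<Union>n. ?B n) \<subseteq> {\<omega> \<in> space ?S. percolates {v \<in> V. \<omega> v} E}" by blast
  have "{\<omega> \<in> space ?S. percolates {v \<in> V. \<omega> v} E} \<in> events"
    using pred_percolates_site_measure[OF V] unfolding pred_def .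
  then have "prob (space ?S - (\<Union>n. ?B n)) \<le> prob {\<omega> \<in> space ?S. percolates {v \<in> V. \<omega> v} E}"
    by (rule finite_measure_mono[OF sub])
  moreover have "prob (space ?S - (\<Union>n. ?B n)) > 0"
    using prob_compl[OF U] small by simp
  ultimately show ?thesis unfolding site_perc_prob_eq by linarith
qed

lemma site_critical_prob_less_1:
  fixes \<iota> :: "nat \<times> nat \<Rightarrow> 'v"
  assumes "countable V" "inj \<iota>" "range \<iota> \<subseteq> V"
    and "\<And>a b. grid_adj a b \<Longrightarrow> E (\<iota> a) (\<iota> b)"
  shows "site_critical_prob V E < 1"
proof -
  have "p \<le> 1 - 1 / 162" if "p \<in> {0..1}" "site_perc_prob V E p = 0" for p
    using site_perc_prob_pos[where \<iota> = \<iota> and V = V and E = E and p = p] assms that by force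
  moreover have "0 \<in> {p \<in> {0..1}. site_perc_prob V E p = 0}"
    using site_perc_prob_0[OF assms(1)] by simp
  ultimately have "site_critical_prob V E \<le> 1 - 1 / 162"
    unfolding site_critical_prob_def by (intro cSup_least) blast+
  then show ?thesis by simp
qed

lemma site_perc_prob_above_critical:
  assumes "site_critical_prob V E < p" "0 \<le> p" "p \<le> 1"
  shows "site_perc_prob V E p \<noteq> 0"
proof
  assume "site_perc_prob V E p = 0"
  then have "p \<le> site_critical_prob V E"
    unfolding site_critical_prob_def using assms
    by (intro cSup_upper bdd_aboveI[of _ 1]) auto
  then show False using assms by simp
qed

section \<open>Comparison with AB percolation\<close>

text \<open>Choose \<open>f v\<close> in \<open>\<Phi> \<omega>\<close> and \<open>g v\<close> in
  \<open>\<Psi> \<omega>\<close> from every open cell \<open>c v\<close>. For adjacent cells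
  \<open>u\<close> and \<open>v\<close> the point \<open>g v\<close> is within \<open>2 * r\<close>
  of both \<open>f u\<close> and \<open>f v\<close>, hence links them, and disjoint cells make
  \<open>f\<close> injective.\<close>

lemma site_perc_prob_le_AB_perc_prob:
  fixes \<Phi> \<Psi> :: "'w \<Rightarrow> 'a::euclidean_space set" and c :: "'v \<Rightarrow> 'a set"
  assumes PP: "indep_poisson_processes M lam \<mu> \<Phi> \<Psi>" and V: "countable V" "V \<noteq> {}"
    and disj: "disjoint_family_on c V"
    and c: "\<And>v. v \<in> V \<Longrightarrow> c v \<in> sets borel" "\<And>v. v \<in> V \<Longrightarrow> bounded (c v)"
      "\<And>v. v \<in> V \<Longrightarrow> measure lborel (c v) = a" and a: "a > 0"
    and near: "\<And>u v x y. u \<in> V \<Longrightarrow> v \<in> V \<Longrightarrow> u = v \<or> E u v \<Longrightarrow> x \<in> c u \<Longrightarrow> y \<in> c v \<Longrightarrow> dist x y \<le> 2 * r"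
    and irrefl: "\<And>u. \<not> E u u"
  shows "site_perc_prob V E ((1 - exp (- lam * a)) * (1 - exp (- \<mu> * a))) \<le> AB_perc_prob M \<Phi> \<Psi> r"
proof -
  let ?q = "(1 - exp (- lam * a)) * (1 - exp (- \<mu> * a))"
  let ?X = "\<lambda>\<omega>. \<lambda>v\<in>V. both_hit \<Phi> \<Psi> (c v) \<omega>"
  let ?P = "\<Pi>\<^sub>M v\<in>V. count_space UNIV :: bool measure"
  have M: "prob_space M" and \<Phi>: "poisson_process M lam \<Phi>" and \<Psi>: "poisson_process M \<mu> \<Psi>"
    using PP by (auto simp: indep_poisson_processes_def)
  interpret prob_space M by fact
  have distr: "distr M ?P ?X = site_measure V ?q"
    unfolding site_measure_def by (rule distr_both_hit[OF PP V(2) disj c a refl])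
  have X: "?X \<in> measurable M ?P"
    by (rule measurable_restrict, rule distr_both_hit(2)[OF PP V(2) disj c a refl])
  have S: "{\<omega> \<in> space ?P. percolates {v \<in> V. \<omega> v} E} \<in> sets ?P"
  proof -
    have "Measurable.pred ?P (\<lambda>\<omega>. percolates {v \<in> V. \<omega> v} E)"
      by (rule pred_site_percolates[OF V(1)]) (rule measurable_component_singleton)
    then show ?thesis unfolding pred_def .
  qed
  have space: "space (site_measure V ?q) = space ?P"
    unfolding site_measure_def by (simp add: space_PiM)
  have "site_perc_prob V E ?q = measure (distr M ?P ?X) {\<omega> \<in> space ?P. percolates {v \<in> V. \<omega> v} E}"
    unfolding site_perc_prob_eq distr space ..
  also have "\<dots> = prob (?X -` {\<omega> \<in> space ?P. percolates {v \<in> V. \<omega> v} E} \<inter> space M)"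
    by (rule measure_distr[OF X S])
  also have "\<dots> \<le> prob {\<omega> \<in> space M. percolates (\<Phi> \<omega>) (AB_adj (\<Psi> \<omega>) r)}"
  proof (rule finite_measure_mono)
    show "{\<omega> \<in> space M. percolates (\<Phi> \<omega>) (AB_adj (\<Psi> \<omega>) r)} \<in> events"
      using pred_AB_percolates[OF poisson_process_measurable[OF \<Phi>] poisson_process_measurable[OF \<Psi>]]
      unfolding pred_def .
    show "?X -` {\<omega> \<in> space ?P. percolates {v \<in> V. \<omega> v} E} \<inter> space M
      \<subseteq> {\<omega> \<in> space M. percolates (\<Phi> \<omega>) (AB_adj (\<Psi> \<omega>) r)}"
    proof safe
      fix \<omega> assume "percolates {v \<in> V. ?X \<omega> v} E"
      moreover define W where "W = {v \<in> V. both_hit \<Phi> \<Psi> (c v) \<omega>}"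
      moreover have "{v \<in> V. ?X \<omega> v} = W" by (auto simp: W_def)
      ultimately have perc: "percolates W E" by simp
      have WV: "v \<in> V" if "v \<in> W" for v using that by (simp add: W_def)
      have "\<forall>v\<in>W. \<exists>x. x \<in> \<Phi> \<omega> \<and> x \<in> c v" "\<forall>v\<in>W. \<exists>y. y \<in> \<Psi> \<omega> \<and> y \<in> c v"
        unfolding W_def both_hit_def by blast+
      then obtain f g where f: "\<forall>v\<in>W. f v \<in> \<Phi> \<omega> \<and> f v \<in> c v" and g: "\<forall>v\<in>W. g v \<in> \<Psi> \<omega> \<and> g v \<in> c v"
        by (metis (no_types))
      have inj: "inj_on f W"
      proof (rule inj_onI, rule ccontr)
        fix u v assume uv: "u \<in> W" "v \<in> W" "f u = f v" "u \<noteq> v"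
        then have "c u \<inter> c v = {}" using disj WV unfolding disjoint_family_on_def by blast
        then show False using uv f by (metis IntI empty_iff)
      qed
      show "percolates (\<Phi> \<omega>) (AB_adj (\<Psi> \<omega>) r)"
        using perc inj
      proof (rule percolates_map)
        show "f ` W \<subseteq> \<Phi> \<omega>" using f by blast
        fix u v assume uv: "u \<in> W" "v \<in> W" "E u v"
        have "u \<noteq> v" using uv irrefl by blast
        then have "f u \<noteq> f v" using inj uv by (meson inj_onD)
        moreover have "dist (f u) (g v) \<le> 2 * r" "dist (f v) (g v) \<le> 2 * r"
          using near WV uv f g by blast+
        ultimately show "AB_adj (\<Psi> \<omega>) r (f u) (f v)"
          unfolding AB_adj_def using g uv by blast
      qed
    qed
  qed
  finally show ?thesis unfolding AB_perc_prob_def .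
qed

text \<open>Abstract cells let flowers and cubes share the argument. For \<open>\<mu>\<close> above
  the bound, \<open>q\<close> exceeds the critical probability, so site percolation and with it AB
  percolation have positive probability.\<close>

lemma mu_c_le:
  fixes \<Phi> \<Psi> :: "real \<Rightarrow> 'w \<Rightarrow> 'a::euclidean_space set" and c :: "'v \<Rightarrow> 'a set"
  assumes PP: "\<And>\<mu>. \<mu> > 0 \<Longrightarrow> indep_poisson_processes (M \<mu>) lam \<mu> (\<Phi> \<mu>) (\<Psi> \<mu>)"
    and V: "countable V" "V \<noteq> {}"
    and disj: "disjoint_family_on c V"
    and c: "\<And>v. v \<in> V \<Longrightarrow> c v \<in> sets borel" "\<And>v. v \<in> V \<Longrightarrow> bounded (c v)"
      "\<And>v. v \<in> V \<Longrightarrow> measure lborel (c v) = a" and a: "a > 0"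
    and near: "\<And>u v x y. u \<in> V \<Longrightarrow> v \<in> V \<Longrightarrow> u = v \<or> E u v \<Longrightarrow> x \<in> c u \<Longrightarrow> y \<in> c v \<Longrightarrow> dist x y \<le> 2 * r"
    and irrefl: "\<And>u. \<not> E u u"
    and pc: "site_critical_prob V E < 1" and lam: "lam > 0"
    and lam_gt: "lam > - ln (1 - site_critical_prob V E) / a"
  shows "mu_c M \<Phi> \<Psi> r \<le> ennreal (- (1 / a) * ln (1 - site_critical_prob V E / (1 - exp (- lam * a))))"
proof -
  let ?p = "site_critical_prob V E" and ?l = "1 - exp (- lam * a)"
  have "- (lam * a) < ln (1 - ?p)" using lam_gt a by (simp add: field_simps)
  then have "exp (- (lam * a)) < exp (ln (1 - ?p))" by simp
  then have "exp (- (lam * a)) < 1 - ?p" using pc by simp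
  then have pl: "?p < ?l" by simp
  have l: "?l > 0" using lam a by simp
  \<comment> \<open>The hypothesis on \<open>lam\<close> makes the argument of the outer logarithm
    positive, where \<open>exp\<close> inverts \<open>ln\<close>.\<close>
  then have Z: "1 - ?p / ?l > 0" using pl by simp
  have "ennreal \<mu> \<le> ennreal (- (1 / a) * ln (1 - ?p / ?l))"
    if \<mu>: "\<mu> > 0" and 0: "AB_perc_prob (M \<mu>) (\<Phi> \<mu>) (\<Psi> \<mu>) r = 0" for \<mu>
  proof (rule ccontr)
    assume "\<not> ?thesis"
    then have "\<mu> > - (1 / a) * ln (1 - ?p / ?l)" using \<mu> by (metis ennreal_leI not_le)
    then have "- (\<mu> * a) < ln (1 - ?p / ?l)" using a by (simp add: field_simps)
    then have "exp (- (\<mu> * a)) < exp (ln (1 - ?p / ?l))" by simp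
    then have "exp (- (\<mu> * a)) < 1 - ?p / ?l" unfolding exp_ln[OF Z] .
    then have "?p / ?l < 1 - exp (- \<mu> * a)" by simp
    then have q: "?p < ?l * (1 - exp (- \<mu> * a))" using l by (simp add: pos_divide_less_eq mult.commute)
    have "0 \<le> ?l * (1 - exp (- \<mu> * a))" "?l * (1 - exp (- \<mu> * a)) \<le> 1"
      using l \<mu> a by (auto intro!: mult_nonneg_nonneg mult_le_one)
    from site_perc_prob_above_critical[OF q this]
    have "site_perc_prob V E (?l * (1 - exp (- \<mu> * a))) \<noteq> 0" .
    moreover have "site_perc_prob V E (?l * (1 - exp (- \<mu> * a))) \<ge> 0"
      by (simp add: site_perc_prob_eq)
    moreover have "site_perc_prob V E (?l * (1 - exp (- \<mu> * a))) \<le> AB_perc_prob (M \<mu>) (\<Phi> \<mu>) (\<Psi> \<mu>) r"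
      by (rule site_perc_prob_le_AB_perc_prob[where E = E, OF PP[OF \<mu>] V disj c a]) (use near irrefl in blast)+
    ultimately show False using 0 by simp
  qed
  then show ?thesis unfolding mu_c_def by (intro Sup_least) blast
qed

section \<open>Cubic cells\<close>

lemma countable_int_lattice: "countable (int_lattice d)"
  unfolding int_lattice_def by (rule countable_PiE) auto

lemma int_lattice_zero: "(\<lambda>i\<in>{..<d}. 0) \<in> int_lattice d"
  by (auto simp: int_lattice_def)

lemma linf_adj_irrefl: "d > 0 \<Longrightarrow> \<not> linf_adj d z z"
proof -
  assume "d > 0"
  then have "(\<lambda>i. \<bar>z i - z i\<bar>) ` {..<d} = {0}" by auto
  then show ?thesis unfolding linf_adj_def by simp
qed

lemma linf_adj_bound:
  assumes "linf_adj d z w" "i < d"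
  shows "\<bar>z i - w i\<bar> \<le> 1"
proof -
  have "\<bar>z i - w i\<bar> \<le> (MAX i\<in>{..<d}. \<bar>z i - w i\<bar>)" using assms(2) by (intro Max_ge) auto
  then show ?thesis using assms(1) by (simp add: linf_adj_def)
qed

definition grid_to_int_lattice :: "nat \<Rightarrow> nat \<times> nat \<Rightarrow> nat \<Rightarrow> int" where
  "grid_to_int_lattice d a = (\<lambda>i\<in>{..<d}. if i = 0 then int (fst a) else if i = 1 then int (snd a) else 0)"

lemma site_critical_prob_int_lattice:
  assumes "d \<ge> 2"
  shows "site_critical_prob (int_lattice d) (linf_adj d) < 1"
proof (rule site_critical_prob_less_1[OF countable_int_lattice])
  let ?\<iota> = "grid_to_int_lattice d"
  have v: "?\<iota> a 0 = int (fst a)" "?\<iota> a 1 = int (snd a)" for a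
    using assms by (auto simp: grid_to_int_lattice_def)
  show "inj ?\<iota>"
  proof (rule injI)
    fix a b assume "?\<iota> a = ?\<iota> b"
    then have "?\<iota> a 0 = ?\<iota> b 0" "?\<iota> a 1 = ?\<iota> b 1" by simp_all
    then show "a = b" unfolding v by (simp add: prod_eq_iff)
  qed
  show "range ?\<iota> \<subseteq> int_lattice d" by (auto simp: int_lattice_def grid_to_int_lattice_def split: if_splits)
  fix a b assume adj: "grid_adj a b"
  show "linf_adj d (?\<iota> a) (?\<iota> b)"
    unfolding linf_adj_def
  proof (rule Max_eqI)
    show "y \<le> 1" if "y \<in> (\<lambda>i. \<bar>?\<iota> a i - ?\<iota> b i\<bar>) ` {..<d}" for y
      using that adj by (auto simp: grid_to_int_lattice_def grid_adj_def)
    have "\<bar>?\<iota> a 0 - ?\<iota> b 0\<bar> = 1 \<or> \<bar>?\<iota> a 1 - ?\<iota> b 1\<bar> = 1"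
      using adj unfolding v by (auto simp: grid_adj_def)
    then show "1 \<in> (\<lambda>i. \<bar>?\<iota> a i - ?\<iota> b i\<bar>) ` {..<d}"
      using assms by (auto simp: image_iff intro: bexI[of _ 0] bexI[of _ 1])
  qed auto
qed

text \<open>\<open>e\<close> numbers the coordinates: lattice sites are functions on
  \<open>{..<d}\<close>, whereas points are indexed by the type \<open>'n\<close>.\<close>

definition cube_cell :: "real \<Rightarrow> ('n \<Rightarrow> nat) \<Rightarrow> (nat \<Rightarrow> int) \<Rightarrow> (real ^ 'n) set" where
  "cube_cell s e z = {x. \<forall>i. s * of_int (z (e i)) \<le> x $ i \<and> x $ i < s * (of_int (z (e i)) + 1)}"

lemma cube_cell_borel: "cube_cell s e z \<in> sets borel"
proof -
  have "cube_cell s e z = (\<Inter>i. {x. s * of_int (z (e i)) \<le> x $ i} \<inter> {x. x $ i < s * (of_int (z (e i)) + 1)})"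
    unfolding cube_cell_def by auto
  also have "\<dots> \<in> sets borel"
  proof (intro sets.finite_INT sets.Int)
    fix i :: 'a
    have "closed {x :: real ^ 'a. s * of_int (z (e i)) \<le> x $ i}"
      by (intro closed_Collect_le continuous_intros)
    then show "{x :: real ^ 'a. s * of_int (z (e i)) \<le> x $ i} \<in> sets borel" by (rule borel_closed)
    have "open {x :: real ^ 'a. x $ i < s * (of_int (z (e i)) + 1)}"
      by (intro open_Collect_less continuous_intros)
    then show "{x :: real ^ 'a. x $ i < s * (of_int (z (e i)) + 1)} \<in> sets borel" by (rule borel_open)
  qed auto
  finally show ?thesis .
qed

text \<open>Open and closed boxes with the same corners have equal volume, so these inclusions
  determine the volume of the half-open cube.\<close>

lemma cube_cell_box:
  "box (\<chi> i. s * of_int (z (e i))) (\<chi> i. s * (of_int (z (e i)) + 1)) \<subseteq> cube_cell s e z"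
  "cube_cell s e z \<subseteq> cbox (\<chi> i. s * of_int (z (e i))) (\<chi> i. s * (of_int (z (e i)) + 1))"
  by (auto simp: cube_cell_def mem_box_cart less_imp_le)

lemma bounded_cube_cell: "bounded (cube_cell s e z)"
  by (rule bounded_subset[OF bounded_cbox cube_cell_box(2)])

lemma measure_cube_cell:
  fixes e :: "'n::finite \<Rightarrow> nat"
  assumes "s > 0"
  shows "measure lborel (cube_cell s e z) = s ^ CARD('n)"
proof -
  let ?l = "\<chi> i. s * of_int (z (e i)) :: real ^ 'n" and ?u = "\<chi> i. s * (of_int (z (e i)) + 1)"
  have le: "?l \<bullet> b \<le> ?u \<bullet> b" "(?u - ?l) \<bullet> b = s" if "b \<in> Basis" for b
    using that assms by (auto simp: Basis_vec_def inner_axis algebra_simps)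
  have "(\<Prod>b\<in>Basis. (?u - ?l) \<bullet> b) = s ^ CARD('n)"
    using le by simp
  then have "emeasure lborel (box ?l ?u) = ennreal (s ^ CARD('n))" "emeasure lborel (cbox ?l ?u) = ennreal (s ^ CARD('n))"
    using le by (simp_all add: emeasure_lborel_box emeasure_lborel_cbox)
  moreover have "emeasure lborel (box ?l ?u) \<le> emeasure lborel (cube_cell s e z)"
    "emeasure lborel (cube_cell s e z) \<le> emeasure lborel (cbox ?l ?u)"
    by (intro emeasure_mono cube_cell_box; simp add: cube_cell_borel)+
  ultimately have "emeasure lborel (cube_cell s e z) = ennreal (s ^ CARD('n))" by (metis antisym)
  then show ?thesis using assms by (simp add: measure_def)
qed

lemma disjoint_cube_cells:
  fixes e :: "'n::finite \<Rightarrow> nat"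
  assumes "s > 0" and e: "bij_betw e UNIV {..<d}"
  shows "disjoint_family_on (cube_cell s e) (int_lattice d)"
  unfolding disjoint_family_on_def
proof (intro ballI impI, rule ccontr)
  fix z w assume zw: "z \<in> int_lattice d" "w \<in> int_lattice d" "z \<noteq> w"
    and "cube_cell s e z \<inter> cube_cell s e w \<noteq> {}"
  then obtain x where x: "x \<in> cube_cell s e z" "x \<in> cube_cell s e w" by blast
  \<comment> \<open>The site of a cell is recovered from any point of the cell by rounding
    down.\<close>
  have fl: "v (e i) = \<lfloor>x $ i / s\<rfloor>" if "x \<in> cube_cell s e v" for v i
    using that assms(1) unfolding cube_cell_def
    by (intro floor_unique[symmetric]) (auto simp: field_simps)
  have "z j = w j" for j
  proof (cases "j < d")
    case True
    then obtain i where "j = e i" using e by (auto simp: bij_betw_def)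
    then show ?thesis using fl[OF x(1)] fl[OF x(2)] by simp
  next
    case False
    then show ?thesis using zw by (auto simp: int_lattice_def PiE_def extensional_def)
  qed
  then show False using zw by blast
qed

text \<open>Points of equal or adjacent cubes differ by at most two sides in each coordinate, and
  passing to the norm costs \<open>sqrt CARD('n)\<close>.\<close>

lemma dist_cube_cells:
  fixes e :: "'n::finite \<Rightarrow> nat"
  assumes s: "s > 0" and e: "bij_betw e UNIV {..<CARD('n)}"
    and zw: "z = w \<or> linf_adj CARD('n) z w" and x: "x \<in> cube_cell s e z" and y: "y \<in> cube_cell s e w"
  shows "dist x y \<le> sqrt CARD('n) * (2 * s)"
proof -
  have "\<bar>x $ i - y $ i\<bar> \<le> 2 * s" for i
  proof -
    have "e i < CARD('n)" using e by (auto simp: bij_betw_def)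
    then have "\<bar>z (e i) - w (e i)\<bar> \<le> 1" using zw linf_adj_bound by (cases "z = w") auto
    then have "real_of_int (z (e i)) - real_of_int (w (e i)) \<le> 1" "real_of_int (w (e i)) - real_of_int (z (e i)) \<le> 1"
      by linarith+
    then have "s * (real_of_int (z (e i)) - real_of_int (w (e i))) \<le> s * 1"
      "s * (real_of_int (w (e i)) - real_of_int (z (e i))) \<le> s * 1"
      using s by (intro mult_left_mono; simp)+
    moreover have "s * of_int (z (e i)) \<le> x $ i" "x $ i < s * (of_int (z (e i)) + 1)"
      "s * of_int (w (e i)) \<le> y $ i" "y $ i < s * (of_int (w (e i)) + 1)"
      using x y by (auto simp: cube_cell_def)
    ultimately show ?thesis by (simp add: algebra_simps abs_le_iff)
  qed
  then have "norm ((x - y) $ i) \<le> 2 * s" for i by simp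
  then have "(\<Sum>i\<in>UNIV. (norm ((x - y) $ i))\<^sup>2) \<le> (\<Sum>i\<in>(UNIV :: 'n set). (2 * s)\<^sup>2)"
    by (intro sum_mono power_mono) auto
  then have "(norm (x - y))\<^sup>2 \<le> real CARD('n) * (2 * s)\<^sup>2"
    by (simp add: norm_vec_def L2_set_def sum_nonneg)
  then have "norm (x - y) \<le> sqrt (real CARD('n) * (2 * s)\<^sup>2)" by (rule real_le_rsqrt)
  also have "\<dots> = sqrt CARD('n) * (2 * s)" using s by (simp add: real_sqrt_mult)
  finally show ?thesis by (simp add: dist_norm)
qed

section \<open>Flower cells\<close>

definition tri_vec :: "int \<Rightarrow> int \<Rightarrow> complex" where
  "tri_vec m n = of_int m + of_int n * cis (pi / 3)"

lemma Re_tri_vec: "Re (tri_vec m n) = of_int m + of_int n / 2"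
  and Im_tri_vec: "Im (tri_vec m n) = of_int n * sqrt 3 / 2"
  by (simp_all add: tri_vec_def cos_60 sin_60)

text \<open>The bilinear form of the Eisenstein norm \<open>m * m + m * n + n * n\<close>. The
  integer numerator lets strict bounds on inner products become integer inequalities.\<close>

lemma inner_tri_vec:
  "tri_vec m n \<bullet> tri_vec k l = (2 * of_int (m * k) + of_int (m * l + n * k) + 2 * of_int (n * l)) / 2"
proof -
  have "tri_vec m n \<bullet> tri_vec k l
    = (of_int m + of_int n / 2) * (of_int k + of_int l / 2) + (of_int n * of_int l) * (sqrt 3 * sqrt 3) / 4"
    by (simp add: inner_complex_def Re_tri_vec Im_tri_vec)
  also have "sqrt 3 * sqrt 3 = (3 :: real)" by simp
  finally show ?thesis by (simp add: field_simps)
qed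

lemma tri_vec_diff: "tri_vec m n - tri_vec k l = tri_vec (m - k) (n - l)"
  by (simp add: tri_vec_def algebra_simps)

lemma tri_lattice_eq: "tri_lattice s = {of_real s * tri_vec m n |m n. True}"
  by (simp add: tri_lattice_def tri_vec_def)

lemma tri_vec_eq_iff: "tri_vec m n = tri_vec k l \<longleftrightarrow> m = k \<and> n = l"
  by (auto simp: complex_eq_iff Re_tri_vec Im_tri_vec)

lemma norm_tri_vec: "norm (tri_vec m n) = 1 \<longleftrightarrow> m * m + m * n + n * n = 1"
proof -
  have "norm (tri_vec m n) = 1 \<longleftrightarrow> (norm (tri_vec m n))\<^sup>2 = 1"
    by (metis norm_ge_zero one_power2 power2_eq_imp_eq zero_le_one)
  also have "(norm (tri_vec m n))\<^sup>2 = of_int (m * m + m * n + n * n)"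
    by (simp add: power2_norm_eq_inner inner_tri_vec algebra_simps)
  finally show ?thesis by linarith
qed

lemma countable_tri_lattice: "countable (tri_lattice s)"
proof -
  have "tri_lattice s = range (\<lambda>(m, n). of_real s * tri_vec m n)"
    unfolding tri_lattice_eq by auto
  then show ?thesis by simp
qed

lemma tri_lattice_memI: "of_real s * tri_vec m n \<in> tri_lattice s"
  unfolding tri_lattice_eq by blast

lemma tri_lattice_diff:
  assumes "z \<in> tri_lattice s" "w \<in> tri_lattice s"
  shows "z - w \<in> tri_lattice s"
proof -
  obtain m n k l where "z = of_real s * tri_vec m n" "w = of_real s * tri_vec k l"
    using assms unfolding tri_lattice_eq by blast
  then have "z - w = of_real s * tri_vec (m - k) (n - l)"
    by (simp add: tri_vec_diff[symmetric] right_diff_distrib)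
  then show ?thesis using tri_lattice_memI by metis
qed

lemma zero_in_tri_lattice: "0 \<in> tri_lattice s"
  using tri_lattice_memI[of s 0 0] by (simp add: tri_vec_def)

lemma tri_lattice_add:
  assumes "z \<in> tri_lattice s" "w \<in> tri_lattice s"
  shows "z + w \<in> tri_lattice s"
  using tri_lattice_diff[OF assms(1) tri_lattice_diff[OF zero_in_tri_lattice assms(2)]] by simp

lemma tri_lattice_scale: "z \<in> tri_lattice 1 \<Longrightarrow> of_real s * z \<in> tri_lattice s"
  unfolding tri_lattice_eq by auto

lemma site_critical_prob_tri_lattice: "site_critical_prob (tri_lattice 1) (tri_adj 1) < 1"
proof (rule site_critical_prob_less_1[OF countable_tri_lattice])
  let ?\<iota> = "\<lambda>a :: nat \<times> nat. tri_vec (int (fst a)) (int (snd a))"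
  show "inj ?\<iota>" by (auto intro!: injI simp: tri_vec_eq_iff prod_eq_iff)
  show "range ?\<iota> \<subseteq> tri_lattice 1" using tri_lattice_memI[of 1] by auto
  show "tri_adj 1 (?\<iota> a) (?\<iota> b)" if "grid_adj a b" for a b
  proof -
    have "norm (?\<iota> a - ?\<iota> b) = 1"
      using that unfolding tri_vec_diff norm_tri_vec grid_adj_def by auto
    then show ?thesis by (simp add: tri_adj_def dist_norm)
  qed
qed

section \<open>Flowers and their disjoint punctured versions\<close>

lemma flower_translate:
  assumes z: "z \<in> tri_lattice s"
  shows "x \<in> flower s z \<longleftrightarrow> x - z \<in> flower s 0"
proof -
  have "x \<in> flower s z \<longleftrightarrow> (\<forall>w. w \<in> tri_lattice s \<and> dist z w = s \<longrightarrow> dist (midpoint z w) x \<le> s)"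
    by (auto simp: flower_def tri_adj_def)
  also have "\<dots> \<longleftrightarrow> (\<forall>w. w \<in> tri_lattice s \<and> dist 0 w = s \<longrightarrow> dist (midpoint 0 w) (x - z) \<le> s)"
  proof (intro iffI allI impI)
    fix w assume *: "\<forall>w. w \<in> tri_lattice s \<and> dist z w = s \<longrightarrow> dist (midpoint z w) x \<le> s"
      and w: "w \<in> tri_lattice s \<and> dist 0 w = s"
    have "dist (midpoint z (z + w)) x \<le> s"
      using *[rule_format, of "z + w"] w tri_lattice_add[OF z] by (simp add: dist_norm)
    moreover have "midpoint z (z + w) - x = midpoint 0 w - (x - z)"
      by (simp add: midpoint_def scaleR_conv_of_real field_simps)
    ultimately show "dist (midpoint 0 w) (x - z) \<le> s" by (simp add: dist_norm)
  next
    fix w assume *: "\<forall>w. w \<in> tri_lattice s \<and> dist 0 w = s \<longrightarrow> dist (midpoint 0 w) (x - z) \<le> s"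
      and w: "w \<in> tri_lattice s \<and> dist z w = s"
    have "dist (midpoint 0 (w - z)) (x - z) \<le> s"
      using *[rule_format, of "w - z"] w tri_lattice_diff[OF _ z] by (simp add: dist_norm norm_minus_commute)
    moreover have "midpoint 0 (w - z) - (x - z) = midpoint z w - x"
      by (simp add: midpoint_def scaleR_conv_of_real field_simps)
    ultimately show "dist (midpoint z w) x \<le> s" by (simp add: dist_norm)
  qed
  also have "\<dots> \<longleftrightarrow> x - z \<in> flower s 0" by (auto simp: flower_def tri_adj_def)
  finally show ?thesis .
qed

lemma closed_flower: "closed (flower s z)"
  unfolding flower_def by (intro closed_INT) auto

lemma flower_neighbour:
  assumes "z \<in> tri_lattice s" "s > 0"
  shows "z + of_real s \<in> tri_lattice s \<and> dist z (z + of_real s) = s"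
proof -
  have "of_real s = of_real s * tri_vec 1 0" by (simp add: tri_vec_def)
  then have "of_real s \<in> tri_lattice s" using tri_lattice_memI by metis
  then show ?thesis using assms tri_lattice_add by (simp add: dist_norm)
qed

lemma flower_cball:
  "x \<in> flower s z \<Longrightarrow> w \<in> tri_lattice s \<Longrightarrow> dist z w = s \<Longrightarrow> dist (midpoint z w) x \<le> s"
  by (auto simp: flower_def tri_adj_def)

lemma bounded_flower:
  assumes "s > 0"
  shows "bounded (flower s 0)"
proof (rule bounded_subset[OF bounded_cball])
  show "flower s 0 \<subseteq> cball (midpoint 0 (of_real s)) s"
    using flower_neighbour[OF zero_in_tri_lattice assms] flower_cball[of _ s 0 "of_real s"] by auto
qed

text \<open>The midpoints lie at distance \<open>s / 2\<close> from the centre, so the disc of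
  radius \<open>s / 2\<close> around the centre is inside every disc of the flower.\<close>

lemma flower_measure_pos:
  assumes "s > 0"
  shows "measure lborel (flower s 0) > 0"
proof -
  have sub: "cball 0 (s / 2) \<subseteq> flower s 0"
  proof
    fix x :: complex assume x: "x \<in> cball 0 (s / 2)"
    have "dist (midpoint 0 w) x \<le> s" if "dist 0 w = s" for w
    proof -
      have "dist (midpoint 0 w) x \<le> dist (midpoint 0 w) 0 + dist 0 x" by (rule dist_triangle)
      also have "dist (midpoint 0 w) 0 = s / 2" using that by (simp add: midpoint_def dist_norm)
      finally show ?thesis using x by simp
    qed
    then show "x \<in> flower s 0" by (auto simp: flower_def tri_adj_def)
  qed
  have "0 < measure lborel (cball 0 (s / 2) :: complex set)"
    using assms by (intro content_cball_pos) simp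
  also have "\<dots> \<le> measure lborel (flower s 0)"
  proof (rule measure_mono_fmeasurable[OF sub])
    \<comment> \<open>Finiteness matters here: \<open>measure\<close> is 0 on sets of infinite
      volume.\<close>
    show "flower s 0 \<in> fmeasurable lborel"
      using emeasure_bounded_finite[OF bounded_flower[OF assms]] closed_flower
      by (intro fmeasurableI) (auto simp: borel_closed)
  qed auto
  finally show ?thesis .
qed

text \<open>Neighbouring flowers touch exactly at the midpoint of their centres.\<close>

definition punctured_flower :: "real \<Rightarrow> complex set" where
  "punctured_flower s = flower s 0 - midpoint 0 ` tri_lattice s"

text \<open>For a lattice vector \<open>e\<close> of length \<open>s\<close>, \<open>u\<close> lies in the disc around \<open>- e / 2\<close>, and
  \<open>\<bar>u + e / 2\<bar>\<^sup>2 = \<bar>u - e / 2\<bar>\<^sup>2 + 2 (u \<bullet> e)\<close>.\<close>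

lemma punctured_flower_inner:
  assumes u: "u \<in> punctured_flower s" and e: "e \<in> tri_lattice s" "norm e = s"
  shows "2 * (u \<bullet> e) < s\<^sup>2"
proof -
  have me: "- e \<in> tri_lattice s" using tri_lattice_diff[OF zero_in_tri_lattice e(1)] by simp
  have "dist (midpoint 0 (- e)) u \<le> s"
    using u me e(2) by (intro flower_cball) (auto simp: punctured_flower_def dist_norm)
  then have "norm (u + midpoint 0 e) \<le> s"
    by (simp add: dist_norm midpoint_def norm_minus_commute)
  then have "(norm (u + midpoint 0 e))\<^sup>2 \<le> s\<^sup>2" by (rule power_mono) simp
  moreover have "u \<noteq> midpoint 0 e" using u e by (auto simp: punctured_flower_def)
  then have "(norm (u - midpoint 0 e))\<^sup>2 > 0" by simp
  moreover have "(norm (u + midpoint 0 e))\<^sup>2 = (norm (u - midpoint 0 e))\<^sup>2 + 2 * (u \<bullet> e)"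
    by (simp add: power2_norm_eq_inner midpoint_def inner_add_left inner_add_right inner_diff_left inner_diff_right inner_commute)
  ultimately show ?thesis by linarith
qed

text \<open>By \<open>punctured_flower_inner\<close>, a punctured flower lies in the open Voronoi
  hexagon of its centre. Adding the inequality for \<open>x - z\<close> along \<open>e\<close> to
  the one for \<open>x - w\<close> along \<open>- e\<close> leaves
  \<open>(w - z) \<bullet> e < s\<^sup>2\<close> in all six directions.\<close>

lemma punctured_flower_disjoint:
  assumes s: "s > 0" and z: "z \<in> tri_lattice s" "w \<in> tri_lattice s"
    and x: "x - z \<in> punctured_flower s" "x - w \<in> punctured_flower s"
  shows "z = w"
proof -
  obtain m n where mn: "w - z = of_real s * tri_vec m n"
    using tri_lattice_diff[OF z(2,1)] unfolding tri_lattice_eq by blast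
  have bound: "2 * (m * k) + (m * l + n * k) + 2 * (n * l) < 2" if "k * k + k * l + l * l = 1" for k l
  proof -
    let ?e = "of_real s * tri_vec k l"
    have e: "?e \<in> tri_lattice s" "norm ?e = s" "- ?e \<in> tri_lattice s" "norm (- ?e) = s"
      using s that norm_tri_vec[of k l] tri_lattice_memI[of s k l] tri_lattice_diff[OF zero_in_tri_lattice, of ?e s]
      by (auto simp: norm_mult)
    have "2 * ((x - z) \<bullet> ?e) < s\<^sup>2" "2 * ((x - w) \<bullet> - ?e) < s\<^sup>2"
      using punctured_flower_inner[OF x(1) e(1,2)] punctured_flower_inner[OF x(2) e(3,4)] .
    then have "(w - z) \<bullet> ?e < s\<^sup>2" by (simp add: inner_diff_left)
    also have "(w - z) \<bullet> ?e = s\<^sup>2 * (tri_vec m n \<bullet> tri_vec k l)"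
      unfolding mn scaleR_conv_of_real[symmetric] by (simp add: power2_eq_square)
    finally have "tri_vec m n \<bullet> tri_vec k l < 1" using s by simp
    then have "real_of_int (2 * (m * k) + (m * l + n * k) + 2 * (n * l)) < real_of_int 2"
      by (simp add: inner_tri_vec)
    then show ?thesis by (simp only: of_int_less_iff)
  qed
  have "m = 0 \<and> n = 0"
    \<comment> \<open>The six solutions of \<open>k * k + k * l + l * l = 1\<close> bound
      \<open>2 * m + n\<close>, \<open>m + 2 * n\<close> and \<open>m - n\<close> by 1 in absolute
      value.\<close>
    using bound[of 1 0] bound[of "-1" 0] bound[of 0 1] bound[of 0 "-1"] bound[of 1 "-1"] bound[of "-1" 1]
    by simp
  then show ?thesis using mn by (simp add: tri_vec_def)
qed

lemma measure_punctured_flower: "emeasure lborel (punctured_flower s) = emeasure lborel (flower s 0)"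
proof -
  have "countable (midpoint 0 ` tri_lattice s)" by (intro countable_image countable_tri_lattice)
  then have "midpoint 0 ` tri_lattice s \<in> null_sets lborel" by (rule countable_imp_null_set_lborel)
  then show ?thesis unfolding punctured_flower_def
    by (intro emeasure_Diff_null_set) (auto simp: closed_flower borel_closed)
qed

lemma punctured_flower_borel: "punctured_flower s \<in> sets borel"
proof -
  have "midpoint 0 ` tri_lattice s \<in> sets borel"
    by (rule sets.countable) (auto intro: countable_image countable_tri_lattice)
  then show ?thesis
    unfolding punctured_flower_def by (intro sets.Diff borel_closed[OF closed_flower])
qed

text \<open>The processes live in \<open>real ^ 'n\<close>, the flowers in \<open>complex\<close>.
  Listing the two coordinates gives an isometry; it preserves Lebesgue measure because preimages of
  boxes are boxes with the same sides.\<close>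

lemma vec2_complex_isometry:
  assumes "CARD('n::finite) = 2"
  obtains S :: "real ^ 'n \<Rightarrow> complex"
  where "\<And>x y. dist (S x) (S y) = dist x y" "distr lborel borel S = lborel" "S \<in> borel_measurable borel"
proof -
  obtain i j :: 'n where ij: "UNIV = {i, j}" "i \<noteq> j"
    using assms by (auto simp: card_2_iff)
  define S :: "real ^ 'n \<Rightarrow> complex" where "S x = Complex (x $ i) (x $ j)" for x
  have iso: "dist (S x) (S y) = dist x y" for x y
  proof -
    have "dist x y = sqrt (\<Sum>k\<in>{i, j}. (x $ k - y $ k)\<^sup>2)"
      unfolding dist_norm norm_vec_def L2_set_def ij(1)[symmetric] by simp
    then show ?thesis using ij(2) by (simp add: S_def dist_norm cmod_def)
  qed
  have "continuous_on UNIV S" 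
    by (rule continuous_onI) (use iso in \<open>auto intro: exI\<close>)
  then have meas: "S \<in> borel_measurable borel" by (rule borel_measurable_continuous_onI)
  have "lborel = distr lborel borel S"
  proof (rule lborel_eqI)
    fix l u :: complex assume lu: "\<And>b. b \<in> Basis \<Longrightarrow> l \<bullet> b \<le> u \<bullet> b"
    have le: "Re l \<le> Re u" "Im l \<le> Im u" using lu[of 1] lu[of \<i>] by (auto simp: Basis_complex_def)
    let ?l = "\<chi> k. if k = i then Re l else Im l" and ?u = "\<chi> k. if k = i then Re u else Im u"
    have B: "(Basis :: (real ^ 'n) set) = {axis i 1, axis j 1}"
      using ij(1) by (auto simp: Basis_vec_def)
    have ne: "axis i (1::real) \<noteq> axis j 1" using ij(2) by (simp add: axis_eq_axis)
    have all: "(\<forall>k. P k) \<longleftrightarrow> P i \<and> P j" for P :: "'n \<Rightarrow> bool"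
      using ij(1) by (metis UNIV_I insertE singletonD)
    have "S -` box l u = box ?l ?u"
      using ij(2) by (auto simp: S_def in_box_complex_iff mem_box_cart all)
    then have "emeasure (distr lborel borel S) (box l u) = emeasure lborel (box ?l ?u)"
      using meas by (simp add: emeasure_distr)
    also have "\<dots> = ennreal (\<Prod>b\<in>Basis. (?u - ?l) \<bullet> b)"
      using le ij(2) by (intro emeasure_lborel_box) (auto simp: B inner_axis)
    also have "(\<Prod>b\<in>Basis. (?u - ?l) \<bullet> b) = (Re u - Re l) * (Im u - Im l)"
      using ne ij(2) by (simp add: B inner_axis)
    also have "\<dots> = (\<Prod>b\<in>Basis. (u - l) \<bullet> b)" by (simp add: Basis_complex_def)
    finally show "emeasure (distr lborel borel S) (box l u) = ennreal (\<Prod>b\<in>Basis. (u - l) \<bullet> b)" .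
  qed simp
  then show thesis using that[of S] iso meas by simp
qed

text \<open>Sites are taken from the lattice of edge length 1, for which \<open>p_c\<close> is
  defined; the true edge length \<open>s\<close> enters through the cell and its centre
  \<open>of_real s * z\<close>.\<close>

definition flower_cell :: "(real ^ 'n \<Rightarrow> complex) \<Rightarrow> real \<Rightarrow> complex \<Rightarrow> (real ^ 'n) set" where
  "flower_cell S s z = {x. S x - of_real s * z \<in> punctured_flower s}"

lemma flower_cell_borel:
  assumes S: "S \<in> borel_measurable borel"
  shows "flower_cell S s z \<in> sets borel"
proof -
  have "(\<lambda>x. S x - of_real s * z) \<in> borel_measurable borel"
    by (intro borel_measurable_diff S borel_measurable_const)
  then have "(\<lambda>x. S x - of_real s * z) -` punctured_flower s \<inter> space borel \<in> sets borel"
    by (rule measurable_sets[OF _ punctured_flower_borel])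
  moreover have "flower_cell S s z = (\<lambda>x. S x - of_real s * z) -` punctured_flower s \<inter> space borel"
    by (auto simp: flower_cell_def)
  ultimately show ?thesis by (simp only:)
qed

lemma measure_flower_cell:
  fixes S :: "real ^ 'n::finite \<Rightarrow> complex"
  assumes S: "distr lborel borel S = lborel" "S \<in> borel_measurable borel"
  shows "measure lborel (flower_cell S s z) = measure lborel (flower s 0)"
proof -
  let ?t = "- of_real s * z"
  have "emeasure lborel (punctured_flower s) = emeasure (distr lborel borel ((+) ?t)) (punctured_flower s)"
    unfolding lborel_distr_plus ..
  also have "\<dots> = emeasure lborel ((+) ?t -` punctured_flower s)"
    by (subst emeasure_distr) (auto simp: punctured_flower_borel)
  also have "\<dots> = emeasure (distr lborel borel S) ((+) ?t -` punctured_flower s)"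
    unfolding S(1) ..
  also have "\<dots> = emeasure lborel (S -` ((+) ?t -` punctured_flower s))"
  proof (subst emeasure_distr)
    show "(+) ?t -` punctured_flower s \<in> sets borel"
      using measurable_sets[OF _ punctured_flower_borel, of "(+) ?t" borel s] by simp
  qed (auto simp: S)
  also have "S -` ((+) ?t -` punctured_flower s) = flower_cell S s z"
    by (auto simp: flower_cell_def)
  finally show ?thesis by (simp add: measure_def measure_punctured_flower)
qed

lemma flower_cell_flower:
  assumes "x \<in> flower_cell S s z" "z \<in> tri_lattice 1"
  shows "S x \<in> flower s (of_real s * z)"
  using assms flower_translate[OF tri_lattice_scale[OF assms(2)], of "S x" s]
  by (auto simp: flower_cell_def punctured_flower_def)

text \<open>The disc around the midpoint of two neighbouring centres is one of the six discs of
  either flower, so both points lie in one disc of radius \<open>s\<close>. For equal centres any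
  neighbour supplies the disc.\<close>

lemma dist_flower_cells:
  assumes S: "\<And>x y. dist (S x) (S y) = dist x y" and s: "s > 0"
    and zw: "z \<in> tri_lattice 1" "w \<in> tri_lattice 1" "z = w \<or> tri_adj 1 z w"
    and x: "x \<in> flower_cell S s z" "y \<in> flower_cell S s w"
  shows "dist x y \<le> 2 * s"
proof -
  let ?z = "of_real s * z" and ?w = "of_real s * w"
  have lat: "?z \<in> tri_lattice s" "?w \<in> tri_lattice s" using tri_lattice_scale zw by auto
  have fl: "S x \<in> flower s ?z" "S y \<in> flower s ?w" using flower_cell_flower x zw by auto
  have "\<exists>p. dist p (S x) \<le> s \<and> dist p (S y) \<le> s"
  proof (cases "z = w")
    case True
    then show ?thesis
      using flower_neighbour[OF lat(1) s] flower_cball[OF fl(1)] flower_cball[OF fl(2)] by metis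
  next
    case False
    then have "dist z w = 1" using zw(3) by (simp add: tri_adj_def)
    then have d: "dist ?z ?w = s" "dist ?w ?z = s"
      using s by (simp_all add: dist_norm right_diff_distrib[symmetric] norm_mult norm_minus_commute)
    then show ?thesis
      using flower_cball[OF fl(1) lat(2) d(1)] flower_cball[OF fl(2) lat(1) d(2)] midpoint_sym[of ?z ?w] by metis
  qed
  then obtain p where "dist p (S x) \<le> s" "dist p (S y) \<le> s" by blast
  then have "dist (S x) (S y) \<le> 2 * s" using dist_triangle3[of "S x" "S y" p] by simp
  then show ?thesis by (simp add: S)
qed

lemma bounded_flower_cell:
  assumes S: "\<And>x y. dist (S x) (S y) = dist x y" and s: "s > 0" and z: "z \<in> tri_lattice 1"
  shows "bounded (flower_cell S s z)"
  unfolding bounded_any_center bounded_two_points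
  using dist_flower_cells[OF S s z z] by blast

lemma disjoint_flower_cells:
  assumes s: "s > 0"
  shows "disjoint_family_on (flower_cell S s) (tri_lattice 1)"
  unfolding disjoint_family_on_def
proof (intro ballI impI, rule ccontr)
  fix z w assume zw: "z \<in> tri_lattice 1" "w \<in> tri_lattice 1" "z \<noteq> w"
    and "flower_cell S s z \<inter> flower_cell S s w \<noteq> {}"
  then obtain x where "S x - of_real s * z \<in> punctured_flower s" "S x - of_real s * w \<in> punctured_flower s"
    by (auto simp: flower_cell_def)
  then have "of_real s * z = of_real s * w"
    by (rule punctured_flower_disjoint[OF s tri_lattice_scale[OF zw(1)] tri_lattice_scale[OF zw(2)]])
  then show False using s zw(3) by simp
qed

theorem corollary2p8:
  fixes M :: "real \<Rightarrow> 'w measure"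
    and \<Phi>1 \<Phi>2 :: "real \<Rightarrow> 'w \<Rightarrow> (real ^ 'n) set"
    and lam r :: real
  assumes "CARD('n) \<ge> 2" and "r > 0" and "lam > 0"
    and "\<And>\<mu>. \<mu> > 0 \<Longrightarrow> indep_poisson_processes (M \<mu>) lam \<mu> (\<Phi>1 \<mu>) (\<Phi>2 \<mu>)"
    and "lam > - ln (1 - p_c CARD('n)) / cell_vol CARD('n) (2 * r)"
  shows "mu_c M \<Phi>1 \<Phi>2 r \<le> ennreal (- (1 / cell_vol CARD('n) (2 * r)) *
           ln (1 - p_c CARD('n) / (1 - exp (- lam * cell_vol CARD('n) (2 * r)))))"
proof (cases "CARD('n) = 2")
  case True
  \<comment> \<open>At parameter \<open>2 * r\<close> the lattice has edge length
    \<open>2 * r / 2 = r\<close>.\<close>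
  have pc: "p_c CARD('n) = site_critical_prob (tri_lattice 1) (tri_adj 1)"
    and vol: "cell_vol CARD('n) (2 * r) = measure lborel (flower r 0)"
    using True by (simp_all add: p_c_def cell_vol_def)
  obtain S :: "real ^ 'n \<Rightarrow> complex"
    where S: "\<And>x y. dist (S x) (S y) = dist x y" "distr lborel borel S = lborel" "S \<in> borel_measurable borel"
    using vec2_complex_isometry[OF True] by blast
  show ?thesis
    unfolding pc vol
  proof (rule mu_c_le[where c = "flower_cell S r", OF assms(4)])
    show "countable (tri_lattice 1)" by (rule countable_tri_lattice)
    show "tri_lattice 1 \<noteq> {}" using zero_in_tri_lattice by blast
    show "disjoint_family_on (flower_cell S r) (tri_lattice 1)"
      using assms(2) by (rule disjoint_flower_cells)
    show "flower_cell S r v \<in> sets borel" for v using S(3) by (rule flower_cell_borel)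
    show "bounded (flower_cell S r v)" if "v \<in> tri_lattice 1" for v
      using S(1) assms(2) that by (rule bounded_flower_cell)
    show "measure lborel (flower_cell S r v) = measure lborel (flower r 0)" for v
      using S(2,3) by (rule measure_flower_cell)
    show "measure lborel (flower r 0) > 0" using assms(2) by (rule flower_measure_pos)
    show "dist x y \<le> 2 * r"
      if "u \<in> tri_lattice 1" "v \<in> tri_lattice 1" "u = v \<or> tri_adj 1 u v"
        "x \<in> flower_cell S r u" "y \<in> flower_cell S r v" for u v x y
      using S(1) assms(2) that by (rule dist_flower_cells)
    show "\<not> tri_adj 1 u u" for u by (simp add: tri_adj_def)
    show "site_critical_prob (tri_lattice 1) (tri_adj 1) < 1" by (rule site_critical_prob_tri_lattice)
    show "lam > - ln (1 - site_critical_prob (tri_lattice 1) (tri_adj 1)) / measure lborel (flower r 0)"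
      using assms(5) unfolding pc vol .
  qed (use assms(3) in simp_all)
next
  case False
  let ?d = "CARD('n)"
  \<comment> \<open>The side is \<open>2 * r / (2 * sqrt d)\<close>, whose \<open>d\<close>-th power
    is \<open>cell_vol\<close>; \<open>sqrt d * (2 * ?s)\<close> is then exactly
    \<open>2 * r\<close>.\<close>
  let ?V = "int_lattice ?d" and ?E = "linf_adj ?d" and ?s = "r / sqrt (real ?d)"
  have s: "?s > 0" using assms(2) by simp
  have pc: "p_c ?d = site_critical_prob ?V ?E" and vol: "cell_vol ?d (2 * r) = ?s ^ ?d"
    using False by (simp_all add: p_c_def cell_vol_def)
  obtain e :: "'n \<Rightarrow> nat" where e: "bij_betw e UNIV {..<?d}"
    using ex_bij_betw_finite_nat[of "UNIV :: 'n set"] by (auto simp: atLeast0LessThan)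
  show ?thesis
    unfolding pc vol
  proof (rule mu_c_le[where c = "cube_cell ?s e", OF assms(4)])
    show "countable ?V" by (rule countable_int_lattice)
    show "?V \<noteq> {}" using int_lattice_zero by blast
    show "disjoint_family_on (cube_cell ?s e) ?V" using s e by (rule disjoint_cube_cells)
    show "cube_cell ?s e v \<in> sets borel" for v by (rule cube_cell_borel)
    show "bounded (cube_cell ?s e v)" for v by (rule bounded_cube_cell)
    show "measure lborel (cube_cell ?s e v) = ?s ^ ?d" for v using s by (rule measure_cube_cell)
    show "?s ^ ?d > 0" using s by (rule zero_less_power)
    show "dist x y \<le> 2 * r"
      if "u \<in> ?V" "v \<in> ?V" "u = v \<or> ?E u v" "x \<in> cube_cell ?s e u" "y \<in> cube_cell ?s e v" for u v x y
      using dist_cube_cells[OF s e that(3-5)] by simp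
    show "\<not> ?E u u" for u by (rule linf_adj_irrefl) simp
    show "site_critical_prob ?V ?E < 1" using assms(1) by (rule site_critical_prob_int_lattice)
    show "lam > - ln (1 - site_critical_prob ?V ?E) / ?s ^ ?d" using assms(5) unfolding pc vol .
  qed (use assms(3) in simp_all)
qed

end
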